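(* Let $\ell\in\mathbb N$, $\varrho>1$, $f,g$ real symmetric $\ell\times\ell$ matrices, $I\subseteq\mathbb R$ an interval and $T>0$ with $[0,T]\subseteq I$. Assume that $f$ is $\varrho$-strongly gathering and that $g$ is compatible with $f$ on $I$. Then there exists a unique QSD solution on $[0,T]\times\mathcal X$ to the Nash system $$-\partial_tu^i-\Delta u^i+\tfrac12|D_iu^i|^2+\sum_{j\neq i}D_ju^j\cdot D_ju^i=\bar F^i,\qquad u^i(T,\cdot)=\bar G^i,\qquad i\in\mathbb Z,$$ where $\bar F^i(x)=\frac12\sum_{h,k=0}^{\ell-1}f_{hk}\langle x^{h+i},x^{k+i}\rangle_{\mathbb R^d}$ and $\bar G^i(x)=\frac12\sum_{h,k=0}^{\ell-1}g_{hk}\langle x^{h+i},x^{k+i}\rangle_{\mathbb R^d}$.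
   Context: Matrix entries are indexed by $0,\dots,\ell-1$. Let $\mathbb D$ be the open unit disc in $\mathbb C$, and for $z,w\in\mathbb C$ put $\varphi(z,w)=\sum_{h,k=0}^{\ell-1}f_{hk}z^hw^k$, $\Psi(z,w)=\sum_{h,k=0}^{\ell-1}g_{hk}z^hw^k$. The matrix $f$ is $\varrho$-strongly gathering if $\varphi(z,0)\notin(-\infty,0)$ for all $|z|\le\varrho$. Put $\xi=\sqrt{\varphi(\cdot,0)}$ (principal branch) and $\psi=\Psi(\cdot,0)$. The matrix $g$ is compatible with $f$ on $I$ if $\inf_{t\in I}|\psi(z)\tanh(t\xi(z))+\xi(z)|>0$ for every $z\in\varrho\mathbb D$. Fix $d\ge1$; $\mathcal X=\ell^\infty(\mathbb Z;\mathbb R^d)$, $x=(x^j)_{j\in\mathbb Z}$; $D_j,\Delta_j$ are gradient and Laplacian in $x^j$, $\Delta=\sum_j\Delta_j$. A classical solution is a sequence $(u^i)_{i\in\mathbb Z}$ of real functions on $[0,T]\times\mathcal X$ such that: (S1) each $u^i$ is continuous in $t\in[0,T]$, $C^1$ in $t\in(0,T)$, and $C^2$ in $x\in\mathcal X$ in the Fréchet sense; (S2) for each $i$ the series $\Delta u^i=\sum_j\Delta_ju^i$ and $\sum_{j\ne i}D_ju^j\cdot D_ju^i$ converge uniformly on bounded subsets of $[0,T]\times\mathcal X$; (S3) the system holds pointwise on $(0,T)\times\mathcal X$; (S4) $u^i(T,\cdot)=\bar G^i$ for all $i$. A quadratic shift-invariant directed (QSD) solution is a classical solution of the form $$u^i(t,x)=\tfrac12\sum_{h,k\in\mathbb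 N}c_{hk}(t)\langle x^{h+i},x^{k+i}\rangle_{\mathbb R^d}+d\int_t^T\operatorname{tr}c(s)\,ds$$ for some $c:[0,T]\to\ell^1(\mathbb N^2)$, where $0\in\mathbb N$ and $\operatorname{tr}c=\sum_{h\in\mathbb N}c_{hh}$. *)

theory Defs
  imports "HOL-Analysis.Analysis"
begin

text \<open>
  An \<open>l \<times> l\<close> matrix is a function \<open>nat \<Rightarrow> nat \<Rightarrow> real\<close> of which only the entries with both
  indices in \<open>{..<l}\<close> are ever used.
\<close>

definition symmetric_upto :: "nat \<Rightarrow> (nat \<Rightarrow> nat \<Rightarrow> real) \<Rightarrow> bool" where
  "symmetric_upto l f \<longleftrightarrow> (\<forall>h<l. \<forall>k<l. f h k = f k h)"

definition matrix_symbol :: "nat \<Rightarrow> (nat \<Rightarrow> nat \<Rightarrow> real) \<Rightarrow> complex \<Rightarrow> complex \<Rightarrow> complex" where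
  "matrix_symbol l f z w = (\<Sum>h<l. \<Sum>k<l. complex_of_real (f h k) * z ^ h * w ^ k)"

definition strongly_gathering :: "nat \<Rightarrow> real \<Rightarrow> (nat \<Rightarrow> nat \<Rightarrow> real) \<Rightarrow> bool" where
  "strongly_gathering l \<rho> f \<longleftrightarrow>
     (\<forall>z. cmod z \<le> \<rho> \<longrightarrow> matrix_symbol l f z 0 \<notin> complex_of_real ` {..<0})"

text \<open>
  \<^const>\<open>csqrt\<close> is the principal branch, so on the closed disc of radius \<open>\<rho>\<close> the strong gathering
  property gives \<open>Re \<xi> > 0\<close> or \<open>\<xi> = 0\<close>, and \<open>t \<xi>\<close> is never a pole of \<open>tanh\<close> for real \<open>t\<close>.
  The infimum is one of real numbers, meaningful for \<open>I \<noteq> {}\<close> only.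
\<close>

definition compatible ::
  "nat \<Rightarrow> real \<Rightarrow> (nat \<Rightarrow> nat \<Rightarrow> real) \<Rightarrow> real set \<Rightarrow> (nat \<Rightarrow> nat \<Rightarrow> real) \<Rightarrow> bool" where
  "compatible l \<rho> f I g \<longleftrightarrow>
     (\<forall>z\<in>ball 0 \<rho>.
        let \<xi> = csqrt (matrix_symbol l f z 0); \<psi> = matrix_symbol l g z 0
        in (INF t\<in>I. cmod (\<psi> * tanh (complex_of_real t * \<xi>) + \<xi>)) > 0)"

text \<open>
  The integers carry the discrete topology, so bounded continuous functions on them are exactly
  the bounded sequences, with the supremum norm.
\<close>

type_synonym 'd states = "int \<Rightarrow>\<^sub>C (real ^ 'd)"

definition update_state :: "'d::finite states \<Rightarrow> int \<Rightarrow> real ^ 'd \<Rightarrow> 'd states" where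
  "update_state x j y = Bcontfun ((apply_bcontfun x)(j := y))"

lemma apply_update_state [simp]:
  "apply_bcontfun (update_state x j y) = (apply_bcontfun x)(j := y)"
proof -
  have "bounded (insert y (range (apply_bcontfun x)))"
    by simp
  then have "bounded (range ((apply_bcontfun x)(j := y)))"
    by (rule bounded_subset) auto
  then have "(apply_bcontfun x)(j := y) \<in> bcontfun"
    by (simp add: bcontfun_def)
  then show ?thesis
    by (simp add: update_state_def Bcontfun_inverse)
qed

definition gradient :: "('a::euclidean_space \<Rightarrow> real) \<Rightarrow> 'a \<Rightarrow> 'a" where
  "gradient f y = (THE D. GDERIV f y :> D)"

definition laplacian :: "('a::euclidean_space \<Rightarrow> real) \<Rightarrow> 'a \<Rightarrow> real" where
  "laplacian f y = (\<Sum>b\<in>Basis. (deriv ^^ 2) (\<lambda>s. f (y + s *\<^sub>R b)) 0)"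

definition gradient_at :: "int \<Rightarrow> ('d::finite states \<Rightarrow> real) \<Rightarrow> 'd states \<Rightarrow> real ^ 'd" where
  "gradient_at j v x = gradient (\<lambda>y. v (update_state x j y)) (x j)"

definition laplacian_at :: "int \<Rightarrow> ('d::finite states \<Rightarrow> real) \<Rightarrow> 'd states \<Rightarrow> real" where
  "laplacian_at j v x = laplacian (\<lambda>y. v (update_state x j y)) (x j)"

definition C2_frechet :: "('a::real_normed_vector \<Rightarrow> real) \<Rightarrow> bool" where
  "C2_frechet v \<longleftrightarrow>
     (\<exists>(v' :: 'a \<Rightarrow> 'a \<Rightarrow>\<^sub>L real) (v'' :: 'a \<Rightarrow> 'a \<Rightarrow>\<^sub>L 'a \<Rightarrow>\<^sub>L real).
        (\<forall>x. (v has_derivative blinfun_apply (v' x)) (at x)) \<and>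
        (\<forall>x. (v' has_derivative blinfun_apply (v'' x)) (at x)) \<and>
        continuous_on UNIV v'')"

text \<open>
  Convergence of a series of functions indexed by a set without preferred order: the net of
  finite partial sums converges uniformly.
\<close>

definition uniformly_summable_on :: "('j \<Rightarrow> 'b \<Rightarrow> real) \<Rightarrow> 'j set \<Rightarrow> 'b set \<Rightarrow> bool" where
  "uniformly_summable_on a J B \<longleftrightarrow>
     uniform_limit B (\<lambda>J' p. \<Sum>j\<in>J'. a j p) (\<lambda>p. \<Sum>\<^sub>\<infinity>j\<in>J. a j p) (finite_subsets_at_top J)"

definition classical_solution ::
  "real \<Rightarrow> (int \<Rightarrow> 'd::finite states \<Rightarrow> real) \<Rightarrow> (int \<Rightarrow> 'd states \<Rightarrow> real)
     \<Rightarrow> (int \<Rightarrow> real \<Rightarrow> 'd states \<Rightarrow> real) \<Rightarrow> bool" where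
  "classical_solution T F G u \<longleftrightarrow>
     (\<forall>i.
       (\<forall>x. continuous_on {0..T} (\<lambda>t. u i t x)) \<and>
       (\<forall>x. (\<lambda>t. u i t x) C1_differentiable_on {0<..<T}) \<and>
       (\<forall>t\<in>{0..T}. C2_frechet (u i t))) \<and>
     (\<forall>i B. bounded B \<and> B \<subseteq> {0..T} \<times> UNIV \<longrightarrow>
       uniformly_summable_on (\<lambda>j (t, x). laplacian_at j (u i t) x) UNIV B \<and>
       uniformly_summable_on
         (\<lambda>j (t, x). gradient_at j (u j t) x \<bullet> gradient_at j (u i t) x) (- {i}) B) \<and>
     (\<forall>i. \<forall>t\<in>{0<..<T}. \<forall>x.
       - deriv (\<lambda>s. u i s x) t
       - (\<Sum>\<^sub>\<infinity>j. laplacian_at j (u i t) x)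
       + 1/2 * (norm (gradient_at i (u i t) x))\<^sup>2
       + (\<Sum>\<^sub>\<infinity>j\<in>- {i}. gradient_at j (u j t) x \<bullet> gradient_at j (u i t) x)
       = F i x) \<and>
     (\<forall>i x. u i T x = G i x)"

text \<open>
  Absolute integrability of the trace is part of the meaning of the integral in the formula
  (the library's integral of a non-integrable function is \<open>0\<close>).
\<close>

definition QSD_form ::
  "real \<Rightarrow> (int \<Rightarrow> real \<Rightarrow> 'd::finite states \<Rightarrow> real) \<Rightarrow> bool" where
  "QSD_form T u \<longleftrightarrow>
     (\<exists>c :: real \<Rightarrow> nat \<Rightarrow> nat \<Rightarrow> real.
       (\<forall>t\<in>{0..T}. (\<lambda>(h, k). \<bar>c t h k\<bar>) summable_on UNIV) \<and>
       (\<lambda>s. \<Sum>\<^sub>\<infinity>h. c s h h) absolutely_integrable_on {0..T} \<and>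
       (\<forall>i. \<forall>t\<in>{0..T}. \<forall>x.
         u i t x =
           1/2 * (\<Sum>\<^sub>\<infinity>(h, k). c t h k * (x (int h + i) \<bullet> x (int k + i)))
           + real CARD('d) * integral {t..T} (\<lambda>s. \<Sum>\<^sub>\<infinity>h. c s h h)))"

definition QSD_solution ::
  "real \<Rightarrow> (int \<Rightarrow> 'd::finite states \<Rightarrow> real) \<Rightarrow> (int \<Rightarrow> 'd states \<Rightarrow> real)
     \<Rightarrow> (int \<Rightarrow> real \<Rightarrow> 'd states \<Rightarrow> real) \<Rightarrow> bool" where
  "QSD_solution T F G u \<longleftrightarrow> classical_solution T F G u \<and> QSD_form T u"

definition quadratic_cost ::
  "nat \<Rightarrow> (nat \<Rightarrow> nat \<Rightarrow> real) \<Rightarrow> int \<Rightarrow> 'd::finite states \<Rightarrow> real" where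
  "quadratic_cost l f i x =
     1/2 * (\<Sum>h<l. \<Sum>k<l. f h k * (x (int h + i) \<bullet> x (int k + i)))"

end

theory Submission
  imports Defs "HOL-Complex_Analysis.Complex_Analysis"
begin

text \<open>
  Insert the quadratic ansatz into the Nash system. In a single coordinate \<open>x\<^sup>j\<close> the value \<open>u\<^sup>i\<close> is a
  quadratic polynomial, the trace terms cancel, and with symmetric coefficients the system is
  equivalent to the matrix Riccati equation \<open>c' = H(c) - f\<close>, \<open>c(T) = g\<close>, where
  \<open>H(c)\<^sub>h\<^sub>k = (\<Sum>m\<le>h. c\<^sub>0\<^sub>,\<^sub>h\<^sub>-\<^sub>m * c\<^sub>m\<^sub>k) + (\<Sum>m\<le>k. c\<^sub>0\<^sub>,\<^sub>k\<^sub>-\<^sub>m * c\<^sub>m\<^sub>h) - c\<^sub>0\<^sub>h * c\<^sub>0\<^sub>k\<close>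
  (lemma \<open>drift_series_quadratic_value\<close>). This equation is triangular: the entry \<open>(h, k)\<close> of \<open>H(c)\<close>
  involves entries of index sum at most \<open>h + k\<close>, and it is linear in \<open>c\<^sub>h\<^sub>k\<close> unless \<open>h = k = 0\<close>.

  Uniqueness follows from the triangular form. The coefficients of an arbitrary QSD solution can be
  recovered from its values at states with at most two nonzero coordinates, so they are as regular
  in time as the solution and satisfy the Riccati equation (\<open>QSD_solution_coefficients\<close>). Two
  solutions of that equation agree by induction on \<open>h + k\<close>, because their difference solves a
  homogeneous linear scalar equation with zero terminal value (\<open>matrix_riccati_unique\<close>).

  For existence, the entries must neither blow up nor lose summability before the whole interval is
  covered, and this is where the hypotheses on the symbols enter. In reversed time the generating function
  \<open>\<phi>(t, z)\<close> of the first column solves the scalar Riccati equation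
  \<open>\<phi>' = \<xi>\<^sup>2 - \<phi>\<^sup>2\<close> with \<open>\<phi>(0, \<cdot>) = \<psi>\<close>, for each \<open>z\<close> separately. Its solution is the logarithmic
  time derivative of \<open>\<xi> * cosh (t * \<xi>) + \<psi> * sinh (t * \<xi>)\<close>, a function that compatibility keeps away from zero. Hence
  \<open>\<phi>(t, \<cdot>)\<close> is holomorphic on a disc of radius larger than \<open>1\<close>, and Cauchy's estimate gives geometric
  decay of the first column, uniformly in time (\<open>riccati_taylor_coefficients\<close>). Given the first
  column, the remaining entries solve linear equations, and a Gronwall argument carries the
  geometric decay over to the whole matrix (\<open>matrix_riccati_flow\<close>). With geometric majorants, every
  series of the Nash system converges uniformly on bounded sets and may be differentiated term by
  term (\<open>QSD_solution_solution\<close>).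
\<close>

section \<open>Scalar linear differential equations\<close>

text \<open>
  The integrating factor \<open>exp (- \<integral> k)\<close> turns \<open>x\<close> into a constant. The base point
  \<open>t0\<close> may be either end of the interval: reality of the Riccati coefficients uses the initial
  time, uniqueness of QSD solutions the terminal one. The equation is demanded in the interior
  only, because that is where a classical solution satisfies it.
\<close>

lemma linear_ode_zero:
  fixes k x :: "real \<Rightarrow> real"
  assumes k: "continuous_on {a..b} k" and x: "continuous_on {a..b} x"
    and ode: "\<And>t. a < t \<Longrightarrow> t < b \<Longrightarrow> (x has_real_derivative k t * x t) (at t)"
    and t0: "t0 \<in> {a..b}" "x t0 = 0" and t: "t \<in> {a..b}"
  shows "x t = 0"
proof (cases "a < b")
  case False
  with t0 t have "t = t0" by auto
  with t0 show ?thesis by simp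
next
  case True
  define K where "K t = integral {a..t} k" for t
  define y where "y t = exp (- K t) * x t" for t
  have K': "(K has_real_derivative k s) (at s within {a..b})" if "s \<in> {a..b}" for s
    unfolding K_def has_real_derivative_iff_has_vector_derivative
    using integral_has_vector_derivative[OF k that] .
  have K: "continuous_on {a..b} K"
    using K' DERIV_continuous_on by blast
  have "y s = y a" if "s \<in> {a..b}" for s
  proof (rule DERIV_isconst2[OF True])
    show "continuous_on {a..b} y"
      unfolding y_def by (intro continuous_intros K x)
    fix s assume s: "a < s" "s < b"
    then have "(K has_real_derivative k s) (at s)"
      using K'[of s] at_within_Icc_at[of a s b] by simp
    then show "(y has_real_derivative 0) (at s)"
      unfolding y_def using ode[OF s]
      by (auto intro!: derivative_eq_intros simp: algebra_simps)
  qed (use that in auto)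
  from this[OF t0(1)] this[OF t] t0(2) show ?thesis
    by (simp add: y_def)
qed

lemma variation_of_constants:
  fixes k p :: "real \<Rightarrow> real"
  assumes k: "continuous_on {0..T} k" and p: "continuous_on {0..T} p" and t: "t \<in> {0..T}"
  shows "((\<lambda>t. exp (- integral {0..t} k) * (x0 + integral {0..t} (\<lambda>s. exp (integral {0..s} k) * p s)))
     has_real_derivative
       p t - k t * (exp (- integral {0..t} k) * (x0 + integral {0..t} (\<lambda>s. exp (integral {0..s} k) * p s))))
     (at t within {0..T})"
proof -
  have K: "((\<lambda>t. integral {0..t} k) has_real_derivative k t) (at t within {0..T})" if "t \<in> {0..T}" for t
    unfolding has_real_derivative_iff_has_vector_derivative
    using integral_has_vector_derivative[OF k that] .
  then have "continuous_on {0..T} (\<lambda>t. integral {0..t} k)"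
    using DERIV_continuous_on by blast
  then have "continuous_on {0..T} (\<lambda>s. exp (integral {0..s} k) * p s)"
    by (intro continuous_intros p)
  from integral_has_vector_derivative[OF this t]
  have P: "((\<lambda>t. integral {0..t} (\<lambda>s. exp (integral {0..s} k) * p s)) has_real_derivative
      exp (integral {0..t} k) * p t) (at t within {0..T})"
    unfolding has_real_derivative_iff_has_vector_derivative .
  have e: "exp (- integral {0..t} k) * exp (integral {0..t} k) = 1"
    by (simp flip: exp_add)
  show ?thesis
    by (rule derivative_eq_intros K[OF t] P refl)+ (use e in algebra)
qed

text \<open>
  Gronwall in the form of a barrier: \<open>C * exp (L * t)\<close> is a supersolution as soon as \<open>L\<close> exceeds
  the size \<open>\<kappa>\<close> of the coefficient by enough to absorb the forcing term, and the integrating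
  factor makes its distance from \<open>x\<close> nondecreasing.
\<close>

lemma linear_ode_upper_bound:
  fixes x k p :: "real \<Rightarrow> real"
  assumes k: "continuous_on {0..T} k"
    and x: "\<And>t. t \<in> {0..T} \<Longrightarrow> (x has_real_derivative p t - k t * x t) (at t within {0..T})"
    and x0: "x 0 \<le> C" and C: "C \<ge> 0"
    and k_bound: "\<And>t. t \<in> {0..T} \<Longrightarrow> \<bar>k t\<bar> \<le> \<kappa>"
    and p_bound: "\<And>t. t \<in> {0..T} \<Longrightarrow> p t \<le> (L - \<kappa>) * C * exp (L * t)"
    and t: "t \<in> {0..T}"
  shows "x t \<le> C * exp (L * t)"
proof -
  define K where "K t = integral {0..t} k" for t
  define y where "y t = exp (K t) * (C * exp (L * t) - x t)" for t
  have K': "(K has_real_derivative k s) (at s within {0..T})" if "s \<in> {0..T}" for s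
    unfolding K_def has_real_derivative_iff_has_vector_derivative
    using integral_has_vector_derivative[OF k that] .
  have y': "(y has_real_derivative
      exp (K s) * (C * exp (L * s) * k s + L * C * exp (L * s) - p s)) (at s within {0..T})"
    if s: "s \<in> {0..T}" for s
    unfolding y_def
    by (rule derivative_eq_intros K'[OF s] x[OF s] refl)+ (simp add: algebra_simps)
  have "y 0 \<le> y t"
  proof (rule DERIV_nonneg_imp_increasing_open[where f = y])
    show "0 \<le> t" using t by simp
    have "continuous_on {0..T} y"
      by (rule DERIV_continuous_on[OF y'])
    then show "continuous_on {0..t} y"
      by (rule continuous_on_subset) (use t in auto)
    fix s assume s: "0 < s" "s < t"
    then have sT: "s \<in> {0..T}" "at s within {0..T} = at s"
      using t by (auto intro!: at_within_Icc_at)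
    have "0 \<le> C * exp (L * s) * (k s + \<kappa>)"
      using k_bound[OF sT(1)] C by (intro mult_nonneg_nonneg) auto
    then have "0 \<le> C * exp (L * s) * k s + L * C * exp (L * s) - p s"
      using p_bound[OF sT(1)] by (simp add: algebra_simps)
    then show "\<exists>d. (y has_real_derivative d) (at s) \<and> 0 \<le> d"
      using y'[OF sT(1)] sT(2) by (metis mult_nonneg_nonneg exp_ge_zero)
  qed
  moreover have "0 \<le> y 0"
    using x0 by (simp add: y_def)
  ultimately have "0 \<le> exp (K t) * (C * exp (L * t) - x t)"
    by (simp add: y_def)
  then show ?thesis
    by (simp add: zero_le_mult_iff)
qed

lemma linear_ode_bound:
  fixes x k p :: "real \<Rightarrow> real"
  assumes k: "continuous_on {0..T} k"
    and x: "\<And>t. t \<in> {0..T} \<Longrightarrow> (x has_real_derivative p t - k t * x t) (at t within {0..T})"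
    and x0: "\<bar>x 0\<bar> \<le> C" and C: "C \<ge> 0"
    and k_bound: "\<And>t. t \<in> {0..T} \<Longrightarrow> \<bar>k t\<bar> \<le> \<kappa>"
    and p_bound: "\<And>t. t \<in> {0..T} \<Longrightarrow> \<bar>p t\<bar> \<le> (L - \<kappa>) * C * exp (L * t)"
    and t: "t \<in> {0..T}"
  shows "\<bar>x t\<bar> \<le> C * exp (L * t)"
proof -
  have "x t \<le> C * exp (L * t)"
    by (rule linear_ode_upper_bound[OF k x _ C k_bound _ t]) (use x0 p_bound in \<open>auto simp: abs_le_iff\<close>)
  moreover have "- x t \<le> C * exp (L * t)"
  proof (rule linear_ode_upper_bound[OF k _ _ C k_bound _ t])
    show "((\<lambda>t. - x t) has_real_derivative - p t - k t * - x t) (at t within {0..T})"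
      if "t \<in> {0..T}" for t
      using DERIV_minus[OF x[OF that]] by (simp add: algebra_simps)
  qed (use x0 p_bound in \<open>auto simp: abs_le_iff\<close>)
  ultimately show ?thesis by simp
qed


section \<open>Taylor coefficients of the scalar Riccati flow\<close>

definition taylor_coeff :: "(complex \<Rightarrow> complex) \<Rightarrow> nat \<Rightarrow> complex" where
  "taylor_coeff F n = (deriv ^^ n) F 0 / fact n"

lemma taylor_coeff_mult:
  assumes "F holomorphic_on ball 0 \<rho>" "G holomorphic_on ball 0 \<rho>" "\<rho> > 0"
  shows "taylor_coeff (\<lambda>z. F z * G z) n = (\<Sum>i\<le>n. taylor_coeff F i * taylor_coeff G (n - i))"
proof -
  have "(deriv ^^ n) (\<lambda>z. F z * G z) 0 =
      (\<Sum>i = 0..n. of_nat (n choose i) * (deriv ^^ i) F 0 * (deriv ^^ (n - i)) G 0)"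
    using assms by (intro higher_deriv_mult) auto
  then show ?thesis
    unfolding taylor_coeff_def
    by (auto simp: sum_divide_distrib atLeast0AtMost binomial_fact field_simps intro!: sum.cong)
qed

lemma taylor_coeff_diff:
  assumes "F holomorphic_on ball 0 \<rho>" "G holomorphic_on ball 0 \<rho>" "\<rho> > 0"
  shows "taylor_coeff (\<lambda>z. F z - G z) n = taylor_coeff F n - taylor_coeff G n"
  using higher_deriv_diff[OF assms(1,2), of 0 n] assms(3)
  by (simp add: taylor_coeff_def diff_divide_distrib)

lemma taylor_coeff_polynomial:
  "taylor_coeff (\<lambda>z. \<Sum>h<l. a h * z ^ h) n = (if n < l then a n else 0)"
proof (induction l)
  case 0
  then show ?case by (simp add: taylor_coeff_def)
next
  case (Suc l)
  have "(deriv ^^ n) (\<lambda>z. (\<Sum>h<l. a h * z ^ h) + a l * z ^ l) 0 =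
      (deriv ^^ n) (\<lambda>z. \<Sum>h<l. a h * z ^ h) 0 + (deriv ^^ n) (\<lambda>z. a l * z ^ l) 0"
    by (rule higher_deriv_add[where S = UNIV]) (auto intro!: holomorphic_intros)
  also have "(deriv ^^ n) (\<lambda>z. a l * z ^ l) 0 = a l * (deriv ^^ n) (\<lambda>z. (z - 0) ^ l) 0"
    unfolding diff_zero by (rule higher_deriv_cmult[where A = UNIV]) (auto intro!: holomorphic_intros)
  also have "(deriv ^^ n) (\<lambda>z::complex. (z - 0) ^ l) 0 = (if n = l then fact n else 0)"
    unfolding higher_deriv_power by (auto simp: pochhammer_fact pochhammer_eq_0_iff power_0_left of_nat_diff)
  finally have "taylor_coeff (\<lambda>z. \<Sum>h<Suc l. a h * z ^ h) n =
      taylor_coeff (\<lambda>z. \<Sum>h<l. a h * z ^ h) n + (if n = l then a l else 0)"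
    by (simp add: taylor_coeff_def add_divide_distrib)
  then show ?case
    unfolding Suc by auto
qed

lemma holomorphic_on_ball_subdisc:
  assumes "F holomorphic_on ball 0 \<rho>" "r < \<rho>"
  shows "F holomorphic_on ball 0 r" "continuous_on (cball 0 r) F"
proof -
  show "F holomorphic_on ball 0 r"
    using assms(2) by (intro holomorphic_on_subset[OF assms(1)]) auto
  have "cball 0 r \<subseteq> ball 0 \<rho>" using assms(2) by auto
  then show "continuous_on (cball 0 r) F"
    using assms(1) holomorphic_on_imp_continuous_on continuous_on_subset by blast
qed

lemma taylor_coeff_bound:
  assumes F: "F holomorphic_on ball 0 \<rho>" and r: "0 < r" "r < \<rho>"
    and B: "\<And>z. cmod z = r \<Longrightarrow> cmod (F z) \<le> B"
  shows "cmod (taylor_coeff F n) \<le> B * (1 / r) ^ n"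
proof -
  have "cmod ((deriv ^^ n) F 0) \<le> fact n * B / r ^ n"
  proof (rule Cauchy_inequality)
    show "F holomorphic_on ball 0 r" "continuous_on (cball 0 r) F"
      using holomorphic_on_ball_subdisc[OF F r(2)] .
  qed (use r B in auto)
  then show ?thesis
    using r by (simp add: taylor_coeff_def norm_divide field_simps)
qed

text \<open>
  By Cauchy's formula a Taylor coefficient is an integral over a fixed circle, with a kernel that
  does not depend on time, so differentiation passes under the integral sign.
\<close>

lemma taylor_coeff_time_derivative:
  fixes F F' :: "real \<Rightarrow> complex \<Rightarrow> complex"
  assumes \<rho>: "\<rho> > 0" and \<tau>: "\<tau> \<in> {0..T}"
    and F: "\<And>t. t \<in> {0..T} \<Longrightarrow> F t holomorphic_on ball 0 \<rho>"
    and F': "\<And>t. t \<in> {0..T} \<Longrightarrow> F' t holomorphic_on ball 0 \<rho>"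
    and der: "\<And>t z. t \<in> {0..T} \<Longrightarrow> z \<in> ball 0 \<rho> \<Longrightarrow>
      ((\<lambda>t. F t z) has_vector_derivative F' t z) (at t within {0..T})"
    and cont: "continuous_on ({0..T} \<times> ball 0 \<rho>) (\<lambda>(t, z). F' t z)"
  shows "((\<lambda>t. taylor_coeff (F t) n) has_vector_derivative taylor_coeff (F' \<tau>) n)
           (at \<tau> within {0..T})"
proof -
  define r where "r = \<rho> / 2"
  have r: "0 < r" "r < \<rho>" using \<rho> by (auto simp: r_def)
  let ?g = "circlepath 0 r"
  define w where "w s = vector_derivative ?g (at s) / (?g s) ^ Suc n / (2 * pi * \<i>)" for s
  have g: "?g s \<in> ball 0 \<rho>" "?g s \<noteq> 0" for s
    using r by (auto simp: circlepath norm_mult)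
  have gc: "continuous_on S ?g" for S
    unfolding circlepath by (intro continuous_intros)
  have w: "continuous_on S w" for S
    unfolding w_def vector_derivative_circlepath
    by (intro continuous_intros gc) (use g in auto)
  have tc: "taylor_coeff G n = integral (cbox 0 1) (\<lambda>s. w s * G (?g s))"
    if "G holomorphic_on ball 0 \<rho>" for G
  proof -
    have "contour_integral ?g (\<lambda>u. G u / (u - 0) ^ Suc n) = 2 * pi * \<i> * (deriv ^^ n) G 0 / fact n"
      using holomorphic_on_ball_subdisc[OF that r(2)] r
      by (intro Cauchy_contour_integral_circlepath) auto
    then have "taylor_coeff G n =
        integral {0..1} (\<lambda>s. G (?g s) / (?g s) ^ Suc n * vector_derivative ?g (at s)) / (2 * pi * \<i>)"
      by (simp add: taylor_coeff_def contour_integral_integral)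
    also have "\<dots> = integral {0..1} (\<lambda>s. w s * G (?g s))"
      unfolding integral_divide[symmetric] w_def by (simp add: field_simps)
    finally show ?thesis by simp
  qed
  have "((\<lambda>t. integral (cbox 0 1) (\<lambda>s. w s * F t (?g s))) has_vector_derivative
      integral (cbox 0 1) (\<lambda>s. w s * F' \<tau> (?g s))) (at \<tau> within {0..T})"
  proof (rule leibniz_rule_vector_derivative)
    fix t s :: real assume t: "t \<in> {0..T}"
    then show "((\<lambda>t. w s * F t (?g s)) has_vector_derivative w s * F' t (?g s)) (at t within {0..T})"
      by (intro has_vector_derivative_mult_right der g)
  next
    fix t assume "t \<in> {0..T}"
    then have "continuous_on (ball 0 \<rho>) (F t)"
      using F holomorphic_on_imp_continuous_on by blast
    then show "(\<lambda>s. w s * F t (?g s)) integrable_on cbox 0 1"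
      by (intro integrable_continuous continuous_on_mult w continuous_on_compose2[OF _ gc])
        (use g in auto)
  next
    have "continuous_on ({0..T} \<times> cbox 0 1) (\<lambda>p. w (snd p) * (case (fst p, ?g (snd p)) of (t, z) \<Rightarrow> F' t z))"
      by (intro continuous_intros continuous_on_compose2[OF w] continuous_on_compose2[OF gc]
          continuous_on_compose2[OF cont]) (use g in auto)
    then show "continuous_on ({0..T} \<times> cbox 0 1) (\<lambda>(t, s). w s * F' t (?g s))"
      by (simp add: case_prod_unfold)
  qed (use \<tau> in auto)
  then have "((\<lambda>t. integral (cbox 0 1) (\<lambda>s. w s * F t (?g s))) has_vector_derivative
      taylor_coeff (F' \<tau>) n) (at \<tau> within {0..T})"
    by (simp only: tc[OF F'[OF \<tau>]])
  then show ?thesis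
    by (rule has_vector_derivative_transform[OF \<tau>, rotated]) (simp add: tc F)
qed

text \<open>
  The two exponentials have different moduli off the imaginary axis.
\<close>

lemma cosh_nonzero_right_half_plane:
  fixes w :: complex
  assumes "Re w > 0"
  shows "cosh w \<noteq> 0"
proof
  assume "cosh w = 0"
  then have "exp w = - exp (- w)"
    by (simp add: cosh_field_def add_eq_0_iff2)
  then have "cmod (exp w) = cmod (exp (- w))"
    by simp
  with assms show False
    by simp
qed

text \<open>
  The equation \<open>\<phi>' = A - \<phi>\<^sup>2\<close> is linearised by \<open>\<phi> = Y' / Y\<close> with \<open>Y'' = A * Y\<close>. With \<open>\<xi> = csqrt A\<close> the
  solution starting at \<open>\<psi>\<close> comes from \<open>Y = \<xi> * cosh (t * \<xi>) + \<psi> * sinh (t * \<xi>)\<close>, which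
  equals \<open>cosh (t * \<xi>) * (\<psi> * tanh (t * \<xi>) + \<xi>)\<close>. Since \<open>Re \<xi> > 0\<close>, the hyperbolic cosine
  has no zeros along the flow, and the remaining factor is the one that compatibility keeps away
  from zero.
\<close>

lemma riccati_holomorphic_flow:
  assumes A: "A holomorphic_on ball 0 \<rho>" "\<And>z. z \<in> ball 0 \<rho> \<Longrightarrow> A z \<notin> \<real>\<^sub>\<le>\<^sub>0"
    and \<psi>: "\<psi> holomorphic_on ball 0 \<rho>"
    and ne: "\<And>t z. t \<in> {0..T} \<Longrightarrow> z \<in> ball 0 \<rho> \<Longrightarrow>
      \<psi> z * tanh (complex_of_real t * csqrt (A z)) + csqrt (A z) \<noteq> 0"
  obtains \<phi> :: "real \<Rightarrow> complex \<Rightarrow> complex" where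
    "\<And>t. t \<in> {0..T} \<Longrightarrow> \<phi> t holomorphic_on ball 0 \<rho>"
    "continuous_on ({0..T} \<times> ball 0 \<rho>) (\<lambda>(t, z). \<phi> t z)"
    "\<And>t z. t \<in> {0..T} \<Longrightarrow> z \<in> ball 0 \<rho> \<Longrightarrow>
      ((\<lambda>t. \<phi> t z) has_vector_derivative A z - \<phi> t z * \<phi> t z) (at t within {0..T})"
    "\<And>z. z \<in> ball 0 \<rho> \<Longrightarrow> \<phi> 0 z = \<psi> z"
proof -
  define \<xi> where "\<xi> z = csqrt (A z)" for z
  define Y :: "complex \<Rightarrow> complex \<Rightarrow> complex" where "Y u z = \<xi> z * cosh (u * \<xi> z) + \<psi> z * sinh (u * \<xi> z)" for u z
  define Y' :: "complex \<Rightarrow> complex \<Rightarrow> complex" where "Y' u z = \<xi> z * (\<xi> z * sinh (u * \<xi> z) + \<psi> z * cosh (u * \<xi> z))" for u z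
  define \<phi> where "\<phi> t z = Y' (complex_of_real t) z / Y (complex_of_real t) z" for t z
  have \<xi>: "\<xi> holomorphic_on ball 0 \<rho>"
    unfolding \<xi>_def using A by (auto intro!: holomorphic_intros)
  have Re_\<xi>: "Re (\<xi> z) > 0" if "z \<in> ball 0 \<rho>" for z
  proof (rule ccontr)
    assume "\<not> Re (\<xi> z) > 0"
    then have "Re (\<xi> z) = 0"
      using csqrt_principal[of "A z"] by (auto simp: \<xi>_def)
    moreover have "A z = \<xi> z * \<xi> z"
      by (simp add: \<xi>_def flip: power2_eq_square)
    ultimately have "A z = complex_of_real (- (Im (\<xi> z) * Im (\<xi> z)))"
      by (simp add: complex_eq_iff)
    then show False
      using A(2)[OF that] by (simp add: complex_nonpos_Reals_iff)
  qed
  have Y: "Y (complex_of_real t) z \<noteq> 0" if t: "t \<in> {0..T}" and z: "z \<in> ball 0 \<rho>" for t z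
  proof -
    have "cosh (complex_of_real t * \<xi> z) \<noteq> 0"
    proof (cases "t = 0")
      case False
      then show ?thesis
        using t Re_\<xi>[OF z] by (intro cosh_nonzero_right_half_plane) auto
    qed simp
    moreover from this have "Y (complex_of_real t) z =
        cosh (complex_of_real t * \<xi> z) * (\<psi> z * tanh (complex_of_real t * \<xi> z) + \<xi> z)"
      by (simp add: Y_def tanh_def field_simps)
    ultimately show ?thesis
      using ne[OF t z] by (simp add: \<xi>_def)
  qed
  show ?thesis
  proof (rule that)
    fix t assume t: "t \<in> {0..T}"
    show "\<phi> t holomorphic_on ball 0 \<rho>"
      unfolding \<phi>_def using Y[OF t] unfolding Y_def Y'_def sinh_field_def cosh_field_def
      by (intro holomorphic_intros \<xi> \<psi>) auto
  next
    have c: "continuous_on ({0..T} \<times> ball 0 \<rho>) (\<lambda>p. \<xi> (snd p))"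
      "continuous_on ({0..T} \<times> ball 0 \<rho>) (\<lambda>p. \<psi> (snd p))"
      using \<xi> \<psi>
      by (auto intro!: continuous_on_compose2[OF _ continuous_on_snd] holomorphic_on_imp_continuous_on
          continuous_intros)
    show "continuous_on ({0..T} \<times> ball 0 \<rho>) (\<lambda>(t, z). \<phi> t z)"
      unfolding \<phi>_def case_prod_unfold using Y
      unfolding Y_def Y'_def sinh_field_def cosh_field_def
      by (intro continuous_intros c) auto
  next
    fix t :: real and z :: complex assume t: "t \<in> {0..T}" and z: "z \<in> ball 0 \<rho>"
    let ?t = "complex_of_real t"
    have d: "((\<lambda>u. Y u z) has_field_derivative Y' u z) (at u)"
      "((\<lambda>u. Y' u z) has_field_derivative \<xi> z * \<xi> z * Y u z) (at u)" for u
      unfolding Y_def Y'_def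
      by (auto intro!: derivative_eq_intros simp: algebra_simps)
    have sq: "\<xi> z * \<xi> z = A z"
      by (simp add: \<xi>_def flip: power2_eq_square)
    have "((\<lambda>u. Y' u z / Y u z) has_field_derivative
        (A z * Y ?t z * Y ?t z - Y' ?t z * Y' ?t z) / (Y ?t z * Y ?t z)) (at ?t)"
      by (rule DERIV_divide[OF d(2)[unfolded sq] d(1) Y[OF t z]])
    also have "(A z * Y ?t z * Y ?t z - Y' ?t z * Y' ?t z) / (Y ?t z * Y ?t z) =
        A z - \<phi> t z * \<phi> t z"
      using Y[OF t z] by (simp add: \<phi>_def field_simps)
    finally show "((\<lambda>t. \<phi> t z) has_vector_derivative A z - \<phi> t z * \<phi> t z) (at t within {0..T})"
      unfolding \<phi>_def[abs_def] by (rule has_vector_derivative_real_field)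
  next
    fix z :: complex assume "z \<in> ball 0 \<rho>"
    then show "\<phi> 0 z = \<psi> z"
      using Re_\<xi>[of z] by (auto simp: \<phi>_def Y_def Y'_def)
  qed
qed

lemma sum_split_ends:
  fixes x :: "nat \<Rightarrow> 'a::comm_monoid_add"
  assumes "n > 0"
  shows "(\<Sum>i\<le>n. x i) = x 0 + (\<Sum>i\<in>{0<..<n}. x i) + x n"
proof -
  have "{..n} = insert 0 (insert n {0<..<n})" using assms by auto
  then show ?thesis using assms by (simp add: ac_simps)
qed

text \<open>
  Comparing Taylor coefficients in the scalar Riccati equation gives the quadratic recursion for
  \<open>b\<close>; the Cauchy estimate on a circle of radius between \<open>1\<close> and \<open>\<rho>\<close> gives geometric decay,
  uniformly in time by compactness.
\<close>

lemma riccati_taylor_coefficients: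
  fixes a p :: "nat \<Rightarrow> real"
  assumes \<rho>: "\<rho> > 1" and T: "T \<ge> 0"
    and A: "A holomorphic_on ball 0 \<rho>" "\<And>z. z \<in> ball 0 \<rho> \<Longrightarrow> A z \<notin> \<real>\<^sub>\<le>\<^sub>0"
    and \<psi>: "\<psi> holomorphic_on ball 0 \<rho>"
    and ne: "\<And>t z. t \<in> {0..T} \<Longrightarrow> z \<in> ball 0 \<rho> \<Longrightarrow>
      \<psi> z * tanh (complex_of_real t * csqrt (A z)) + csqrt (A z) \<noteq> 0"
    and a: "\<And>n. taylor_coeff A n = complex_of_real (a n)"
    and p: "\<And>n. taylor_coeff \<psi> n = complex_of_real (p n)"
  obtains b :: "nat \<Rightarrow> real \<Rightarrow> real" and M q :: real where
    "0 < q" "q < 1" "\<And>n t. t \<in> {0..T} \<Longrightarrow> \<bar>b n t\<bar> \<le> M * q ^ n"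
    "\<And>n. b n 0 = p n"
    "\<And>n t. t \<in> {0..T} \<Longrightarrow>
      (b n has_real_derivative a n - (\<Sum>i\<le>n. b i t * b (n - i) t)) (at t within {0..T})"
proof -
  obtain \<phi> :: "real \<Rightarrow> complex \<Rightarrow> complex" where
    hol: "\<And>t. t \<in> {0..T} \<Longrightarrow> \<phi> t holomorphic_on ball 0 \<rho>" and
    cont: "continuous_on ({0..T} \<times> ball 0 \<rho>) (\<lambda>(t, z). \<phi> t z)" and
    der: "\<And>t z. t \<in> {0..T} \<Longrightarrow> z \<in> ball 0 \<rho> \<Longrightarrow>
      ((\<lambda>t. \<phi> t z) has_vector_derivative A z - \<phi> t z * \<phi> t z) (at t within {0..T})" and
    \<phi>0: "\<And>z. z \<in> ball 0 \<rho> \<Longrightarrow> \<phi> 0 z = \<psi> z"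
    using riccati_holomorphic_flow[OF A \<psi> ne] by blast
  define \<beta> where "\<beta> n t = taylor_coeff (\<phi> t) n" for n t
  have \<rho>0: "\<rho> > 0" using \<rho> by simp
  have der\<beta>: "(\<beta> n has_vector_derivative a n - (\<Sum>i\<le>n. \<beta> i t * \<beta> (n - i) t)) (at t within {0..T})"
    if t: "t \<in> {0..T}" for n t
  proof -
    have A_cont: "continuous_on ({0..T} \<times> ball 0 \<rho>) (\<lambda>p. A (snd p))"
      by (rule continuous_on_compose2[OF holomorphic_on_imp_continuous_on[OF A(1)]])
        (auto intro!: continuous_intros)
    have "((\<lambda>t. taylor_coeff (\<phi> t) n) has_vector_derivative
        taylor_coeff (\<lambda>z. A z - \<phi> t z * \<phi> t z) n) (at t within {0..T})"
    proof (rule taylor_coeff_time_derivative[OF \<rho>0 t hol _ der])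
      show "continuous_on ({0..T} \<times> ball 0 \<rho>) (\<lambda>(t, z). A z - \<phi> t z * \<phi> t z)"
        using cont A_cont unfolding case_prod_unfold by (intro continuous_intros)
    qed (auto intro!: holomorphic_intros A hol)
    also have "taylor_coeff (\<lambda>z. A z - \<phi> t z * \<phi> t z) n =
        a n - (\<Sum>i\<le>n. \<beta> i t * \<beta> (n - i) t)"
      unfolding \<beta>_def using hol[OF t] \<rho>0 A(1) a
      by (subst taylor_coeff_diff taylor_coeff_mult, auto intro!: holomorphic_intros)+
    finally show ?thesis unfolding \<beta>_def[abs_def] .
  qed
  have \<beta>0: "\<beta> n 0 = p n" for n
  proof -
    have "(deriv ^^ n) (\<phi> 0) 0 = (deriv ^^ n) \<psi> 0"
      by (rule higher_deriv_transform_within_open[of _ "ball 0 \<rho>"]) (use hol[of 0] T \<psi> \<phi>0 \<rho>0 in auto)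
    then show ?thesis
      using p by (simp add: \<beta>_def taylor_coeff_def)
  qed
  have cont\<beta>: "continuous_on {0..T} (\<beta> n)" for n
    using der\<beta> has_vector_derivative_continuous by (fastforce simp: continuous_on_eq_continuous_within)
  \<comment> \<open>The imaginary part of the \<open>n\<close>-th equation is linear and homogeneous once the earlier
    coefficients are known to be real; the initial values are real.\<close>
  have Im\<beta>: "Im (\<beta> n t) = 0" if "t \<in> {0..T}" for n t
    using that
  proof (induction n arbitrary: t rule: less_induct)
    case (less n)
    have rhs: "Im (a n - (\<Sum>i\<le>n. \<beta> i t * \<beta> (n - i) t)) = - 2 * Re (\<beta> 0 t) * Im (\<beta> n t)"
      if t: "t \<in> {0..T}" for t
    proof (cases "n = 0")
      case False
      have "(\<Sum>i\<in>{0<..<n}. Im (\<beta> i t * \<beta> (n - i) t)) = 0"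
        using less.IH[OF _ t] by (intro sum.neutral) auto
      then have "Im (\<Sum>i\<le>n. \<beta> i t * \<beta> (n - i) t) = Im (\<beta> 0 t * \<beta> n t) + Im (\<beta> n t * \<beta> 0 t)"
        using False unfolding Im_sum by (subst sum_split_ends) auto
      then show ?thesis
        using less.IH[OF _ t, of 0] False by simp
    qed simp
    show ?case
    proof (rule linear_ode_zero[where x = "\<lambda>t. Im (\<beta> n t)" and k = "\<lambda>t. - 2 * Re (\<beta> 0 t)" and a = 0 and b = T and ?t0.0 = 0])
      show "continuous_on {0..T} (\<lambda>t. - 2 * Re (\<beta> 0 t))" "continuous_on {0..T} (\<lambda>t. Im (\<beta> n t))"
        by (intro continuous_intros cont\<beta>)+
      fix s assume s: "0 < s" "s < T"
      then have "(\<beta> n has_vector_derivative a n - (\<Sum>i\<le>n. \<beta> i s * \<beta> (n - i) s)) (at s)"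
        using der\<beta>[of s n] at_within_Icc_at[of 0 s T] by simp
      from bounded_linear.has_vector_derivative[OF bounded_linear_Im this]
      show "((\<lambda>t. Im (\<beta> n t)) has_real_derivative - 2 * Re (\<beta> 0 s) * Im (\<beta> n s)) (at s)"
        using rhs[of s] s by (simp add: has_real_derivative_iff_has_vector_derivative)
    qed (use less.prems T \<beta>0 in auto)
  qed
  define r where "r = (1 + \<rho>) / 2"
  have r: "1 < r" "r < \<rho>" using \<rho> by (auto simp: r_def)
  have "compact ((\<lambda>(t, z). \<phi> t z) ` ({0..T} \<times> cball 0 r))"
    using r by (intro compact_continuous_image compact_Times continuous_on_subset[OF cont]) auto
  then obtain M where M: "\<And>t z. t \<in> {0..T} \<Longrightarrow> z \<in> cball 0 r \<Longrightarrow> cmod (\<phi> t z) \<le> M"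
    by (fastforce dest!: compact_imp_bounded simp: bounded_iff)
  show ?thesis
  proof (rule that[of "1 / r" "\<lambda>n t. Re (\<beta> n t)" M])
    show "0 < 1 / r" "1 / r < 1" using r by auto
    show "\<bar>Re (\<beta> n t)\<bar> \<le> M * (1 / r) ^ n" if t: "t \<in> {0..T}" for n t
    proof -
      have "cmod (\<beta> n t) \<le> M * (1 / r) ^ n"
        unfolding \<beta>_def using r M t by (intro taylor_coeff_bound[OF hol]) auto
      then show ?thesis
        using abs_Re_le_cmod order_trans by blast
    qed
    show "Re (\<beta> n 0) = p n" for n by (simp add: \<beta>0)
    fix n t assume t: "t \<in> {0..T}"
    have "Re (a n - (\<Sum>i\<le>n. \<beta> i t * \<beta> (n - i) t)) =
        a n - (\<Sum>i\<le>n. Re (\<beta> i t) * Re (\<beta> (n - i) t))"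
      using Im\<beta>[OF t] by simp
    with bounded_linear.has_vector_derivative[OF bounded_linear_Re der\<beta>[OF t, of n]]
    show "((\<lambda>t. Re (\<beta> n t)) has_real_derivative
        a n - (\<Sum>i\<le>n. Re (\<beta> i t) * Re (\<beta> (n - i) t))) (at t within {0..T})"
      by (simp add: has_real_derivative_iff_has_vector_derivative)
  qed
qed

section \<open>The matrix Riccati flow\<close>

text \<open>
  Once the first column \<open>b\<close> is known, the other entries of the Riccati flow solve linear equations
  with coefficient \<open>- 2 * b 0\<close>, whose forcing term involves entries of smaller index sum only. One
  step solves all these equations by variation of constants, reading the smaller entries off the
  previous iterate; the entry \<open>(h, k)\<close> is therefore final after \<open>h + k + 1\<close> steps.
\<close>

definition triangular_step ::
  "(nat \<Rightarrow> real \<Rightarrow> real) \<Rightarrow> (nat \<Rightarrow> nat \<Rightarrow> real) \<Rightarrow> (nat \<Rightarrow> nat \<Rightarrow> real)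
     \<Rightarrow> (nat \<Rightarrow> nat \<Rightarrow> real \<Rightarrow> real) \<Rightarrow> nat \<Rightarrow> nat \<Rightarrow> real \<Rightarrow> real" where
  "triangular_step b F G c h k t =
     exp (- integral {0..t} (\<lambda>s. 2 * b 0 s)) *
     (G h k + integral {0..t} (\<lambda>s. exp (integral {0..s} (\<lambda>s. 2 * b 0 s)) *
       (F h k + b h s * b k s - (\<Sum>m<h. b (h - m) s * c m k s) - (\<Sum>m<k. b (k - m) s * c h m s))))"

definition triangular_solution ::
  "(nat \<Rightarrow> real \<Rightarrow> real) \<Rightarrow> (nat \<Rightarrow> nat \<Rightarrow> real) \<Rightarrow> (nat \<Rightarrow> nat \<Rightarrow> real) \<Rightarrow> nat \<Rightarrow> nat \<Rightarrow> real \<Rightarrow> real" where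
  "triangular_solution b F G h k = (triangular_step b F G ^^ Suc (h + k)) (\<lambda>_ _ _. 0) h k"

lemma triangular_step_cong:
  assumes "\<And>h' k'. h' + k' < h + k \<Longrightarrow> c h' k' = c' h' k'"
  shows "triangular_step b F G c h k = triangular_step b F G c' h k"
  using assms by (auto simp: triangular_step_def fun_eq_iff)

lemma triangular_iterates_stabilise:
  assumes "h + k < N"
  shows "(triangular_step b F G ^^ N) c0 h k = (triangular_step b F G ^^ Suc (h + k)) c0 h k"
  using assms
proof (induction "h + k" arbitrary: h k N rule: less_induct)
  case less
  then obtain N' where N: "N = Suc N'" "h + k \<le> N'"
    by (metis less_imp_Suc_add le_add1)
  have "(triangular_step b F G ^^ N') c0 h' k' = (triangular_step b F G ^^ (h + k)) c0 h' k'"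
    if "h' + k' < h + k" for h' k'
    using less(1)[OF that, of N'] less(1)[OF that, of "h + k"] that N by simp
  then show ?case
    unfolding N by (auto intro: triangular_step_cong)
qed

lemma triangular_solution_fixpoint:
  "triangular_solution b F G h k = triangular_step b F G (triangular_solution b F G) h k"
proof -
  have "triangular_solution b F G h k =
      triangular_step b F G ((triangular_step b F G ^^ (h + k)) (\<lambda>_ _ _. 0)) h k"
    by (simp add: triangular_solution_def)
  also have "\<dots> = triangular_step b F G (triangular_solution b F G) h k"
    unfolding triangular_solution_def by (intro triangular_step_cong triangular_iterates_stabilise)
  finally show ?thesis .
qed

lemma triangular_solution_zero: "triangular_solution b F G h k 0 = G h k"
  by (subst triangular_solution_fixpoint) (simp add: triangular_step_def)

lemma triangular_solution_symmetric:
  assumes "\<And>h k. F h k = F k h" "\<And>h k. G h k = G k h"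
  shows "triangular_solution b F G h k t = triangular_solution b F G k h t"
proof (induction "h + k" arbitrary: h k t rule: less_induct)
  case less
  have "(\<Sum>m<h. b (h - m) s * triangular_solution b F G m k s) =
      (\<Sum>m<h. b (h - m) s * triangular_solution b F G k m s)"
    "(\<Sum>m<k. b (k - m) s * triangular_solution b F G h m s) =
      (\<Sum>m<k. b (k - m) s * triangular_solution b F G m h s)" for s
    using less by (auto intro!: sum.cong)
  then show ?case
    using assms(1)[of h k] assms(2)[of h k]
    unfolding triangular_solution_fixpoint[of b F G h k] triangular_solution_fixpoint[of b F G k h]
    by (simp add: triangular_step_def algebra_simps)
qed

lemma triangular_solution_derivative:
  assumes b: "\<And>n. continuous_on {0..T} (b n)" and t: "t \<in> {0..T}"
  shows "(triangular_solution b F G h k has_real_derivative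
     (F h k + b h t * b k t - (\<Sum>m<h. b (h - m) t * triangular_solution b F G m k t)
        - (\<Sum>m<k. b (k - m) t * triangular_solution b F G h m t))
      - 2 * b 0 t * triangular_solution b F G h k t) (at t within {0..T})"
  using t
proof (induction "h + k" arbitrary: h k t rule: less_induct)
  case less
  let ?c = "triangular_solution b F G"
  have "continuous_on {0..T} (?c h' k')" if "h' + k' < h + k" for h' k'
    by (rule DERIV_continuous_on[OF less(1)[OF that]])
  then have p: "continuous_on {0..T} (\<lambda>s. F h k + b h s * b k s
      - (\<Sum>m<h. b (h - m) s * ?c m k s) - (\<Sum>m<k. b (k - m) s * ?c h m s))"
    by (intro continuous_intros b) auto
  have "continuous_on {0..T} (\<lambda>s. 2 * b 0 s)"
    by (intro continuous_intros b)
  from variation_of_constants[OF this p less.prems, of "G h k"]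
  show ?case
    unfolding triangular_step_def[symmetric] triangular_solution_fixpoint[symmetric]
    by simp
qed

text \<open>
  Convolution with a sequence of decay rate \<open>q\<close> preserves any slower decay rate \<open>r\<close>; the price is
  the constant \<open>M / (1 - q / r)\<close>, which does not depend on \<open>h\<close>.
\<close>

lemma geometric_convolution_bound:
  fixes b c :: "nat \<Rightarrow> real"
  assumes q: "0 < q" "q < r" and M: "M \<ge> 0" and D: "D \<ge> 0"
    and b: "\<And>n. \<bar>b n\<bar> \<le> M * q ^ n" and c: "\<And>m. m < h \<Longrightarrow> \<bar>c m\<bar> \<le> D * r ^ (m + k)"
  shows "\<bar>\<Sum>m<h. b (h - m) * c m\<bar> \<le> M / (1 - q / r) * D * r ^ (h + k)"
proof -
  have r: "r > 0" and \<theta>: "0 < q / r" "q / r < 1" using q by auto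
  have "\<bar>\<Sum>m<h. b (h - m) * c m\<bar> \<le> (\<Sum>m<h. M * q ^ (h - m) * (D * r ^ (m + k)))"
    using b c M D q
    by (intro order.trans[OF sum_abs] sum_mono) (auto simp: abs_mult intro!: mult_mono)
  also have "\<dots> = (\<Sum>m<h. M * D * r ^ (h + k) * (q / r) ^ (h - m))"
  proof (rule sum.cong)
    fix m assume "m \<in> {..<h}"
    then have "r ^ (h + k) = r ^ (m + k) * r ^ (h - m)"
      by (simp add: add.commute flip: power_add)
    then show "M * q ^ (h - m) * (D * r ^ (m + k)) = M * D * r ^ (h + k) * (q / r) ^ (h - m)"
      using r by (simp add: power_divide)
  qed simp
  also have "\<dots> = M * D * r ^ (h + k) * (\<Sum>m<h. (q / r) ^ (h - m))"
    by (simp add: sum_distrib_left)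
  also have "\<dots> \<le> M * D * r ^ (h + k) * (1 / (1 - q / r))"
  proof (rule mult_left_mono)
    have "(\<Sum>m<h. (q / r) ^ (h - m)) = (\<Sum>m\<in>{1..h}. (q / r) ^ m)"
      by (rule sum.reindex_bij_witness[of _ "\<lambda>m. h - m" "\<lambda>m. h - m"]) auto
    also have "\<dots> \<le> (\<Sum>m. (q / r) ^ m)"
      using \<theta> by (intro sum_le_suminf summable_geometric) auto
    also have "\<dots> = 1 / (1 - q / r)"
      using \<theta> by (intro suminf_geometric) auto
    finally show "(\<Sum>m<h. (q / r) ^ (h - m)) \<le> 1 / (1 - q / r)" .
  qed (use M D r in simp)
  finally show ?thesis
    by (simp add: mult_ac)
qed

text \<open>
  Induction on the index sum with the barrier \<open>C * r ^ (h + k) * exp (L * t)\<close>. The constant \<open>L\<close> is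
  chosen once, so large that it dominates the coefficient \<open>2 * b 0\<close> and the two convolutions with
  \<open>b\<close>; hence nothing deteriorates along the induction. The rate \<open>r\<close> has to be worse than the rate
  \<open>q\<close> of \<open>b\<close> for these convolutions to be bounded.
\<close>

lemma triangular_solution_bound:
  assumes q: "0 < q" "q < r" "r < 1" and T: "T \<ge> 0"
    and b: "\<And>n. continuous_on {0..T} (b n)"
    and b_bound: "\<And>n t. t \<in> {0..T} \<Longrightarrow> \<bar>b n t\<bar> \<le> M * q ^ n"
    and F: "\<And>h k. \<bar>F h k\<bar> \<le> P * q ^ (h + k)" and G: "\<And>h k. \<bar>G h k\<bar> \<le> P * q ^ (h + k)"
  obtains K where "\<And>h k t. t \<in> {0..T} \<Longrightarrow> \<bar>triangular_solution b F G h k t\<bar> \<le> K * r ^ (h + k)"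
proof -
  let ?c = "triangular_solution b F G"
  have M: "M \<ge> 0" using b_bound[of 0 0] T by simp
  have P: "P \<ge> 0" using order.trans[OF abs_ge_zero F[of 0 0]] by simp
  define C where "C = P + M\<^sup>2"
  define S where "S = M / (1 - q / r)"
  \<comment> \<open>Room for the source terms, for the two convolutions, and for the coefficient \<open>2 * b 0\<close>.\<close>
  define L where "L = 1 + 2 * S + 2 * M"
  have C: "C \<ge> 0" "P \<le> C" using P by (auto simp: C_def)
  have S: "S \<ge> 0" using M q by (simp add: S_def field_simps)
  have L: "L \<ge> 0" using S M by (simp add: L_def)
  have qr: "q ^ n \<le> r ^ n" for n
    using q by (intro power_mono) auto
  have main: "\<bar>?c h k t\<bar> \<le> (C * r ^ (h + k)) * exp (L * t)" if "t \<in> {0..T}" for h k t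
    using that
  proof (induction "h + k" arbitrary: h k t rule: less_induct)
    case less
    show ?case
    proof (rule linear_ode_bound[where k = "\<lambda>s. 2 * b 0 s" and \<kappa> = "2 * M" and x = "?c h k" and
          p = "\<lambda>s. F h k + b h s * b k s - (\<Sum>m<h. b (h - m) s * ?c m k s)
            - (\<Sum>m<k. b (k - m) s * ?c h m s)"])
      show "(?c h k has_real_derivative
          (F h k + b h s * b k s - (\<Sum>m<h. b (h - m) s * ?c m k s)
            - (\<Sum>m<k. b (k - m) s * ?c h m s)) - 2 * b 0 s * ?c h k s) (at s within {0..T})"
        if "s \<in> {0..T}" for s
        by (rule triangular_solution_derivative[OF b that])
      show "t \<in> {0..T}" by (rule less.prems)
      show "continuous_on {0..T} (\<lambda>t. 2 * b 0 t)"
        by (intro continuous_intros b)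
      have "P * q ^ (h + k) \<le> C * r ^ (h + k)"
        using P C qr q by (intro mult_mono) auto
      then show "\<bar>?c h k 0\<bar> \<le> C * r ^ (h + k)"
        using G[of h k] by (simp add: triangular_solution_zero)
      show "0 \<le> C * r ^ (h + k)" using C q by simp
      show "\<bar>2 * b 0 s\<bar> \<le> 2 * M" if "s \<in> {0..T}" for s
        using b_bound[OF that, of 0] by simp
      fix s assume s: "s \<in> {0..T}"
      let ?E = "exp (L * s)" and ?R = "r ^ (h + k)"
      have E: "?E \<ge> 1" using L s by simp
      have R: "?R > 0" using q by simp
      have "\<bar>F h k + b h s * b k s\<bar> \<le> P * q ^ (h + k) + (M * q ^ h) * (M * q ^ k)"
        using F[of h k] mult_mono[OF b_bound[OF s, of h] b_bound[OF s, of k]] M q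
        by (intro order.trans[OF abs_triangle_ineq] add_mono) (auto simp: abs_mult)
      also have "\<dots> = C * q ^ (h + k)"
        by (simp add: C_def power_add power2_eq_square algebra_simps)
      also have "\<dots> \<le> C * ?R * ?E"
        using mult_mono[OF mult_left_mono[OF qr[of "h + k"] C(1)] E] C R by simp
      finally have 1: "\<bar>F h k + b h s * b k s\<bar> \<le> C * ?R * ?E" .
      have IH: "\<bar>?c h' k' s\<bar> \<le> (C * ?E) * r ^ (h' + k')" if "h' + k' < h + k" for h' k'
        using less(1)[OF that s] by (simp add: mult_ac)
      have D: "0 \<le> C * ?E" using C by simp
      have 2: "\<bar>\<Sum>m<h. b (h - m) s * ?c m k s\<bar> \<le> S * (C * ?E) * r ^ (h + k)"
        unfolding S_def by (rule geometric_convolution_bound[OF q(1,2) M D b_bound[OF s] IH]) simp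
      have 3: "\<bar>\<Sum>m<k. b (k - m) s * ?c h m s\<bar> \<le> S * (C * ?E) * r ^ (k + h)"
        unfolding S_def
      proof (rule geometric_convolution_bound[OF q(1,2) M D b_bound[OF s]])
        fix m assume "m < k"
        then show "\<bar>?c h m s\<bar> \<le> C * ?E * r ^ (m + h)"
          using IH[of h m] by (simp add: add.commute)
      qed
      have "\<bar>F h k + b h s * b k s - (\<Sum>m<h. b (h - m) s * ?c m k s) - (\<Sum>m<k. b (k - m) s * ?c h m s)\<bar>
          \<le> C * ?R * ?E + S * (C * ?E) * ?R + S * (C * ?E) * ?R"
        using 1 2 3 unfolding add.commute[of k h] by linarith
      also have "\<dots> = (L - 2 * M) * (C * ?R) * ?E"
        by (simp add: L_def algebra_simps)
      finally show "\<bar>F h k + b h s * b k s - (\<Sum>m<h. b (h - m) s * ?c m k s) - (\<Sum>m<k. b (k - m) s * ?c h m s)\<bar>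
          \<le> (L - 2 * M) * (C * ?R) * ?E" .
    qed
  qed
  show ?thesis
  proof (rule that[of "C * exp (L * T)"])
    fix h k t assume t: "t \<in> {0..T}"
    have "(C * r ^ (h + k)) * exp (L * t) \<le> (C * r ^ (h + k)) * exp (L * T)"
    proof (rule mult_left_mono)
      show "exp (L * t) \<le> exp (L * T)"
        using mult_left_mono[of t T L] L t by simp
    qed (use C q in simp)
    then show "\<bar>?c h k t\<bar> \<le> C * exp (L * T) * r ^ (h + k)"
      using main[OF t, of h k] by (simp add: mult_ac)
  qed
qed

text \<open>
  The Hamiltonian part of the Nash system, applied to the quadratic form with symmetric matrix \<open>c\<close>,
  is half the quadratic form with this matrix. In terms of generating functions it is
  \<open>(\<phi>(z) + \<phi>(w)) * \<Phi>(z, w) - \<phi>(z) * \<phi>(w)\<close> with \<open>\<phi> = \<Phi>(\<cdot>, 0)\<close>: the two convolutions come from the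
  transport terms \<open>D\<^sub>j u\<^sup>j \<cdot> D\<^sub>j u\<^sup>i\<close>, taken over all \<open>j \<ge> i\<close>, and the last product corrects for
  the factor one half in front of \<open>\<bar>D\<^sub>i u\<^sup>i\<bar>\<^sup>2\<close>.
\<close>

definition hamiltonian_coeff :: "(nat \<Rightarrow> nat \<Rightarrow> real) \<Rightarrow> nat \<Rightarrow> nat \<Rightarrow> real" where
  "hamiltonian_coeff c h k =
     (\<Sum>m\<le>h. c 0 (h - m) * c m k) + (\<Sum>m\<le>k. c 0 (k - m) * c m h) - c 0 h * c 0 k"

text \<open>
  The coefficients of a QSD solution are indexed by all pairs of natural numbers, while the entries
  of the data outside the \<open>l \<times> l\<close> block are meaningless.
\<close>

definition zero_extension :: "nat \<Rightarrow> (nat \<Rightarrow> nat \<Rightarrow> real) \<Rightarrow> nat \<Rightarrow> nat \<Rightarrow> real" where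
  "zero_extension l f h k = (if h < l \<and> k < l then f h k else 0)"

lemma zero_extension_symmetric:
  "symmetric_upto l f \<Longrightarrow> zero_extension l f h k = zero_extension l f k h"
  by (auto simp: zero_extension_def symmetric_upto_def)

lemma zero_extension_geometric_bound:
  fixes q :: real
  assumes "0 < q" "q < 1"
  obtains P where "\<And>h k. \<bar>zero_extension l f h k\<bar> \<le> P * q ^ (h + k)"
proof
  fix h k
  let ?S = "\<Sum>h<l. \<Sum>k<l. \<bar>f h k\<bar>"
  have S: "?S \<ge> 0" by (intro sum_nonneg) auto
  show "\<bar>zero_extension l f h k\<bar> \<le> ?S / q ^ (l + l) * q ^ (h + k)"
  proof (cases "h < l \<and> k < l")
    case True
    have "\<bar>f h k\<bar> \<le> (\<Sum>k<l. \<bar>f h k\<bar>)"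
      using True by (intro member_le_sum) auto
    also have "\<dots> \<le> ?S"
      using True by (intro member_le_sum[where f = "\<lambda>h. \<Sum>k<l. \<bar>f h k\<bar>"]) (auto intro: sum_nonneg)
    finally have 1: "\<bar>f h k\<bar> \<le> ?S" .
    have "q ^ (l + l) \<le> q ^ (h + k)"
      using assms True by (intro power_decreasing) auto
    then have "?S * 1 \<le> ?S * (q ^ (h + k) / q ^ (l + l))"
      using assms S by (intro mult_left_mono) auto
    then show ?thesis
      using 1 True by (simp add: zero_extension_def)
  next
    case False
    then have "zero_extension l f h k = 0" by (auto simp: zero_extension_def)
    then show ?thesis using S assms by simp
  qed
qed

lemma matrix_symbol_at_0:
  "matrix_symbol l f z 0 = (\<Sum>h<l. complex_of_real (f h 0) * z ^ h)"
  unfolding matrix_symbol_def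
proof (rule sum.cong)
  fix h assume "h \<in> {..<l}"
  then have "{..<l} = insert 0 {0<..<l}" by auto
  then show "(\<Sum>k<l. complex_of_real (f h k) * z ^ h * 0 ^ k) = complex_of_real (f h 0) * z ^ h"
    by simp
qed simp

text \<open>
  At time \<open>0\<close> compatibility says that \<open>\<xi>\<close> has no zeros; together with strong gathering this puts
  the symbol into the domain where the principal square root is holomorphic.
\<close>

lemma strongly_gathering_compatible_nondegenerate:
  assumes sg: "strongly_gathering l \<rho> f" and comp: "compatible l \<rho> f I g"
    and I: "{0..T} \<subseteq> I" and T: "T \<ge> 0" and z: "z \<in> ball 0 \<rho>"
  shows "t \<in> {0..T} \<Longrightarrow> matrix_symbol l g z 0 *
           tanh (complex_of_real t * csqrt (matrix_symbol l f z 0)) + csqrt (matrix_symbol l f z 0) \<noteq> 0"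
    and "matrix_symbol l f z 0 \<notin> \<real>\<^sub>\<le>\<^sub>0"
proof -
  define \<xi> \<psi> where "\<xi> = csqrt (matrix_symbol l f z 0)" and "\<psi> = matrix_symbol l g z 0"
  let ?D = "\<lambda>t. cmod (\<psi> * tanh (complex_of_real t * \<xi>) + \<xi>)"
  have pos: "(INF t\<in>I. ?D t) > 0"
    using comp z by (auto simp: compatible_def Let_def \<xi>_def \<psi>_def)
  have ne: "\<psi> * tanh (complex_of_real t * \<xi>) + \<xi> \<noteq> 0" if "t \<in> {0..T}" for t
  proof -
    have "(INF t\<in>I. ?D t) \<le> ?D t"
      using that I by (intro cINF_lower bdd_belowI2[of _ 0]) auto
    with pos show ?thesis by auto
  qed
  then show "t \<in> {0..T} \<Longrightarrow> matrix_symbol l g z 0 *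
      tanh (complex_of_real t * csqrt (matrix_symbol l f z 0)) + csqrt (matrix_symbol l f z 0) \<noteq> 0"
    unfolding \<xi>_def \<psi>_def .
  have "\<xi> \<noteq> 0" using ne[of 0] T by simp
  then have "matrix_symbol l f z 0 \<noteq> 0" by (auto simp: \<xi>_def)
  moreover have "matrix_symbol l f z 0 \<notin> complex_of_real ` {..<0}"
    using sg z by (auto simp: strongly_gathering_def)
  ultimately show "matrix_symbol l f z 0 \<notin> \<real>\<^sub>\<le>\<^sub>0"
    unfolding nonpos_Reals_def by (auto simp: image_iff less_le)
qed

text \<open>
  Both columns solve the same linear equation once the earlier entries agree. This closes the loop:
  the sequence that drives the triangular system is a column of its solution, so that solution
  obeys the quadratic matrix equation.
\<close>

lemma triangular_solution_first_column:
  assumes T: "T \<ge> 0" and t: "t \<in> {0..T}"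
    and b: "\<And>n t. t \<in> {0..T} \<Longrightarrow>
      (b n has_real_derivative F n 0 - (\<Sum>i\<le>n. b i t * b (n - i) t)) (at t within {0..T})"
    and b0: "\<And>n. b n 0 = G n 0"
  shows "triangular_solution b F G n 0 t = b n t"
  using t
proof (induction n arbitrary: t rule: less_induct)
  case (less n)
  let ?c = "triangular_solution b F G"
  have bc: "continuous_on {0..T} (b n)" for n
    by (rule DERIV_continuous_on[OF b])
  have d: "((\<lambda>s. ?c n 0 s - b n s) has_real_derivative - 2 * b 0 s * (?c n 0 s - b n s)) (at s within {0..T})"
    if s: "s \<in> {0..T}" for s
  proof -
    have "(\<Sum>m<n. b (n - m) s * ?c m 0 s) = (\<Sum>m<n. b m s * b (n - m) s)"
      using less.IH[OF _ s] by (intro sum.cong) auto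
    moreover have "(\<Sum>i\<le>n. b i s * b (n - i) s) = (\<Sum>m<n. b m s * b (n - m) s) + b n s * b 0 s"
      by (simp add: lessThan_Suc_atMost[symmetric])
    ultimately show ?thesis
      using DERIV_diff[OF triangular_solution_derivative[where b = b and F = F and G = G and h = n and k = 0, OF bc s] b[OF s, of n]]
      by (simp add: algebra_simps)
  qed
  have "?c n 0 t - b n t = 0"
  proof (rule linear_ode_zero[where x = "\<lambda>s. ?c n 0 s - b n s" and k = "\<lambda>s. - 2 * b 0 s"])
    show "continuous_on {0..T} (\<lambda>s. - 2 * b 0 s)"
      by (intro continuous_intros bc)
    show "continuous_on {0..T} (\<lambda>s. ?c n 0 s - b n s)"
      by (rule DERIV_continuous_on[OF d])
    show "((\<lambda>s. ?c n 0 s - b n s) has_real_derivative - 2 * b 0 s * (?c n 0 s - b n s)) (at s)"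
      if "0 < s" "s < T" for s
      using d[of s] at_within_Icc_at[OF that] that by simp
    show "0 \<in> {0..T}" using T by simp
    show "t \<in> {0..T}" by (rule less.prems)
    show "?c n 0 0 - b n 0 = 0"
      by (simp add: triangular_solution_zero b0)
  qed
  then show ?case by simp
qed

text \<open>
  The time variable is the time to maturity, so the terminal matrix is the initial value.
\<close>

theorem matrix_riccati_flow:
  assumes \<rho>: "\<rho> > 1" and f: "symmetric_upto l f" and g: "symmetric_upto l g"
    and T: "T > 0" and I: "{0..T} \<subseteq> I"
    and sg: "strongly_gathering l \<rho> f" and comp: "compatible l \<rho> f I g"
  obtains \<gamma> :: "nat \<Rightarrow> nat \<Rightarrow> real \<Rightarrow> real" and K r :: real where
    "0 < r" "r < 1" "\<And>h k t. t \<in> {0..T} \<Longrightarrow> \<bar>\<gamma> h k t\<bar> \<le> K * r ^ (h + k)"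
    "\<And>h k t. \<gamma> h k t = \<gamma> k h t" "\<And>h k. \<gamma> h k 0 = zero_extension l g h k"
    "\<And>h k t. t \<in> {0..T} \<Longrightarrow>
      (\<gamma> h k has_real_derivative
         zero_extension l f h k - hamiltonian_coeff (\<lambda>h k. \<gamma> h k t) h k) (at t within {0..T})"
proof -
  let ?F = "zero_extension l f" and ?G = "zero_extension l g"
  have hol: "(\<lambda>z. matrix_symbol l f z 0) holomorphic_on S" for f S
    unfolding matrix_symbol_at_0 by (intro holomorphic_intros)
  have tc: "taylor_coeff (\<lambda>z. matrix_symbol l f z 0) n = complex_of_real (zero_extension l f n 0)" for f n
    unfolding matrix_symbol_at_0 taylor_coeff_polynomial by (auto simp: zero_extension_def)
  have T0: "T \<ge> 0" using T by simp
  note nd = strongly_gathering_compatible_nondegenerate[OF sg comp I T0]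
  obtain b M q where q: "0 < q" "q < 1" and b_bound: "\<And>n t. t \<in> {0..T} \<Longrightarrow> \<bar>b n t\<bar> \<le> M * q ^ n"
    and b0: "\<And>n. b n 0 = ?G n 0"
    and b: "\<And>n t. t \<in> {0..T} \<Longrightarrow>
      (b n has_real_derivative ?F n 0 - (\<Sum>i\<le>n. b i t * b (n - i) t)) (at t within {0..T})"
    by (rule riccati_taylor_coefficients[where A = "\<lambda>z. matrix_symbol l f z 0" and
          \<psi> = "\<lambda>z. matrix_symbol l g z 0" and a = "\<lambda>n. ?F n 0" and p = "\<lambda>n. ?G n 0",
          OF \<rho> T0 hol nd(2) hol nd(1) tc tc]) (assumption | (rule that; assumption))+
  have bc: "continuous_on {0..T} (b n)" for n
    by (rule DERIV_continuous_on[OF b])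
  obtain P1 where P1: "\<And>h k. \<bar>?F h k\<bar> \<le> P1 * q ^ (h + k)"
    using zero_extension_geometric_bound[OF q] by blast
  obtain P2 where P2: "\<And>h k. \<bar>?G h k\<bar> \<le> P2 * q ^ (h + k)"
    using zero_extension_geometric_bound[OF q] by blast
  \<comment> \<open>Any decay rate strictly between that of the first column and \<open>1\<close> will do.\<close>
  define r where "r = (q + 1) / 2"
  have r: "q < r" "r < 1" using q by (auto simp: r_def)
  have F: "\<bar>?F h k\<bar> \<le> max P1 P2 * q ^ (h + k)" and G: "\<bar>?G h k\<bar> \<le> max P1 P2 * q ^ (h + k)" for h k
    using P1[of h k] P2[of h k] q
    by (auto intro: order.trans mult_right_mono)
  let ?c = "triangular_solution b ?F ?G"
  obtain K where K: "\<And>h k t. t \<in> {0..T} \<Longrightarrow> \<bar>?c h k t\<bar> \<le> K * r ^ (h + k)"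
    by (rule triangular_solution_bound[OF q(1) r T0 bc b_bound F G]) (assumption | (rule that; assumption))+
  have sym: "?c h k t = ?c k h t" for h k t
    by (rule triangular_solution_symmetric) (auto intro: zero_extension_symmetric f g)
  have col: "b n t = ?c 0 n t" if "t \<in> {0..T}" for n t
    using triangular_solution_first_column[where b = b and F = ?F and G = ?G, OF T0 that b b0] sym[of n 0 t] by simp
  show ?thesis
  proof (rule that[of r ?c K])
    show "0 < r" "r < 1" using q r by auto
    show "\<bar>?c h k t\<bar> \<le> K * r ^ (h + k)" if "t \<in> {0..T}" for h k t
      by (rule K[OF that])
    show "?c h k t = ?c k h t" for h k t by (rule sym)
    show "?c h k 0 = ?G h k" for h k by (rule triangular_solution_zero)
    fix h k t assume t: "t \<in> {0..T}"
    have "(?F h k + b h t * b k t - (\<Sum>m<h. b (h - m) t * ?c m k t)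
        - (\<Sum>m<k. b (k - m) t * ?c h m t)) - 2 * b 0 t * ?c h k t
      = ?F h k - hamiltonian_coeff (\<lambda>h k. ?c h k t) h k"
      unfolding hamiltonian_coeff_def
      by (simp add: lessThan_Suc_atMost[symmetric] col[OF t] sym[of h] algebra_simps)
    with triangular_solution_derivative[where b = b and F = ?F and G = ?G and h = h and k = k, OF bc t]
    show "(?c h k has_real_derivative
        ?F h k - hamiltonian_coeff (\<lambda>h k. ?c h k t) h k) (at t within {0..T})"
      by simp
  qed
qed

section \<open>Summable matrices and their quadratic forms\<close>

lemma norm_bound_summable:
  fixes f :: "'a \<Rightarrow> 'b::banach"
  assumes W: "W summable_on A" and f: "\<And>x. x \<in> A \<Longrightarrow> norm (f x) \<le> W x"
  shows "f summable_on A" and "norm (infsum f A) \<le> infsum W A"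
proof -
  have n: "(\<lambda>x. norm (f x)) summable_on A"
    by (rule summable_on_comparison_test[OF W]) (use f in auto)
  then show s: "f summable_on A"
    by (rule abs_summable_summable)
  show "norm (infsum f A) \<le> infsum W A"
    by (rule norm_infsum_le[OF has_sum_infsum[OF s] has_sum_infsum[OF W] f])
qed

lemma inner_infsum_left:
  fixes f :: "'a \<Rightarrow> 'b::{real_inner, banach}"
  assumes "f summable_on A"
  shows "infsum f A \<bullet> w = (\<Sum>\<^sub>\<infinity>x\<in>A. f x \<bullet> w)"
  using has_sum_bounded_linear[OF bounded_linear_inner_left has_sum_infsum[OF assms], of w]
  by (simp add: o_def infsumI)

lemma inner_infsum_right:
  fixes f :: "'a \<Rightarrow> 'b::{real_inner, banach}"
  assumes "f summable_on A"
  shows "w \<bullet> infsum f A = (\<Sum>\<^sub>\<infinity>x\<in>A. w \<bullet> f x)"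
  using inner_infsum_left[OF assms, of w] by (simp add: inner_commute)

definition l1_matrix :: "(nat \<Rightarrow> nat \<Rightarrow> real) \<Rightarrow> bool" where
  "l1_matrix c \<longleftrightarrow> (\<lambda>(h, k). \<bar>c h k\<bar>) summable_on UNIV"

definition row_convolution :: "(nat \<Rightarrow> nat \<Rightarrow> real) \<Rightarrow> nat \<Rightarrow> nat \<Rightarrow> real" where
  "row_convolution c h k = (\<Sum>m\<le>h. c 0 (h - m) * c m k)"

lemma l1_matrix_row:
  assumes "l1_matrix c"
  shows "(\<lambda>k. \<bar>c m k\<bar>) summable_on UNIV"
  using summable_on_SigmaD1[of "\<lambda>h k. \<bar>c h k\<bar>" UNIV "\<lambda>_. UNIV" m] assms
  by (simp add: l1_matrix_def)

lemma l1_matrix_swap: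
  assumes "l1_matrix c"
  shows "l1_matrix (\<lambda>h k. c k h)"
  using assms unfolding l1_matrix_def
  by (subst summable_on_reindex_bij_witness[of UNIV prod.swap prod.swap UNIV "\<lambda>(h, k). \<bar>c h k\<bar>"]) auto

lemma summable_on_product_nonneg:
  fixes a :: "'a \<Rightarrow> real" and b :: "'b \<Rightarrow> real"
  assumes a: "a summable_on A" and b: "b summable_on B"
    and nn: "\<And>x. x \<in> A \<Longrightarrow> a x \<ge> 0" "\<And>y. y \<in> B \<Longrightarrow> b y \<ge> 0"
  shows "(\<lambda>(x, y). a x * b y) summable_on A \<times> B"
proof (rule summable_on_SigmaI)
  show "((\<lambda>y. case (x, y) of (x, y) \<Rightarrow> a x * b y) has_sum a x * infsum b B) B" for x
    using has_sum_cmult_right[OF has_sum_infsum[OF b]] by simp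
  show "(\<lambda>x. a x * infsum b B) summable_on A"
    by (rule summable_on_cmult_left[OF a])
qed (use nn in auto)

lemma l1_matrix_tensor:
  assumes "a summable_on UNIV" "b summable_on UNIV"
  shows "l1_matrix (\<lambda>h k. a h * b k)"
  using summable_on_product_nonneg[OF assms[THEN iffD1[OF summable_on_iff_abs_summable_on_real]]]
  by (simp add: l1_matrix_def abs_mult)

lemma l1_matrix_add:
  assumes "l1_matrix a" "l1_matrix b"
  shows "l1_matrix (\<lambda>h k. a h k + b h k)"
  using norm_bound_summable(1)[OF summable_on_add[OF assms[unfolded l1_matrix_def]],
      of "\<lambda>(h, k). \<bar>a h k + b h k\<bar>"]
  by (auto simp: l1_matrix_def case_prod_unfold)

lemma l1_matrix_scale:
  assumes "l1_matrix a"
  shows "l1_matrix (\<lambda>h k. s * a h k)"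
  using summable_on_cmult_right[OF assms[unfolded l1_matrix_def], of "\<bar>s\<bar>"]
  by (simp add: l1_matrix_def abs_mult case_prod_unfold)

lemma l1_matrix_diff:
  assumes "l1_matrix a" "l1_matrix b"
  shows "l1_matrix (\<lambda>h k. a h k - b h k)"
  using l1_matrix_add[OF assms(1) l1_matrix_scale[OF assms(2), of "-1"]] by simp

lemma l1_matrix_mono:
  assumes "l1_matrix a" "\<And>h k. \<bar>b h k\<bar> \<le> \<bar>a h k\<bar>"
  shows "l1_matrix b"
  using norm_bound_summable(1)[OF assms(1)[unfolded l1_matrix_def], of "\<lambda>(h, k). \<bar>b h k\<bar>"] assms(2)
  by (auto simp: l1_matrix_def)

text \<open>
  The absolute majorant of the triple series behind the transport term; it allows all the
  rearrangements below.
\<close>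

lemma convolution_triples_summable:
  assumes "l1_matrix c"
  shows "(\<lambda>(m, k, n). \<bar>c 0 k\<bar> * \<bar>c m n\<bar>) summable_on UNIV"
proof -
  have "(\<lambda>(k, p). \<bar>c 0 k\<bar> * (case p of (m, n) \<Rightarrow> \<bar>c m n\<bar>)) summable_on UNIV \<times> UNIV"
    by (rule summable_on_product_nonneg[OF l1_matrix_row[OF assms] assms[unfolded l1_matrix_def]]) auto
  then show ?thesis
    by (subst summable_on_reindex_bij_witness[where T = "UNIV \<times> UNIV" and i = "\<lambda>(k, m, n). (m, k, n)"
          and j = "\<lambda>(m, k, n). (k, m, n)" and h = "\<lambda>(k, p). \<bar>c 0 k\<bar> * (case p of (m, n) \<Rightarrow> \<bar>c m n\<bar>)"]) auto
qed

text \<open>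
  Collecting the triples \<open>(m, k, n)\<close> along \<open>m + k = h\<close> is what turns the sum over the players into
  a convolution.
\<close>

lemma convolution_reindex:
  fixes F :: "nat \<times> nat \<times> nat \<Rightarrow> 'b::banach"
  assumes "F summable_on UNIV"
  shows "(\<lambda>(p, m). F (m, fst p - m, snd p)) summable_on (SIGMA p:UNIV. {..fst p})"
    and "infsum F UNIV = (\<Sum>\<^sub>\<infinity>p. \<Sum>m\<le>fst p. F (m, fst p - m, snd p))"
proof -
  have "(\<lambda>(p, m). F (m, fst p - m, snd p)) summable_on (SIGMA p:UNIV. {..fst p})
      \<longleftrightarrow> F summable_on UNIV"
    by (rule summable_on_reindex_bij_witness[where
      j = "\<lambda>(p, m). (m, fst p - m, snd p)" and i = "\<lambda>(m, k, n). ((m + k, n), m)"]) auto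
  with assms show s: "(\<lambda>(p, m). F (m, fst p - m, snd p)) summable_on (SIGMA p:UNIV. {..fst p})"
    by simp
  have "infsum F UNIV = (\<Sum>\<^sub>\<infinity>(p, m)\<in>(SIGMA p:UNIV. {..fst p}). F (m, fst p - m, snd p))"
    by (rule infsum_reindex_bij_witness[where
      i = "\<lambda>(p, m). (m, fst p - m, snd p)" and j = "\<lambda>(m, k, n). ((m + k, n), m)"]) auto
  also have "\<dots> = (\<Sum>\<^sub>\<infinity>p. \<Sum>\<^sub>\<infinity>m\<in>{..fst p}. F (m, fst p - m, snd p))"
    by (rule infsum_Sigma'_banach[OF s, symmetric])
  finally show "infsum F UNIV = (\<Sum>\<^sub>\<infinity>p. \<Sum>m\<le>fst p. F (m, fst p - m, snd p))"
    by simp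
qed

lemma l1_matrix_row_convolution:
  assumes "l1_matrix c"
  shows "l1_matrix (row_convolution c)"
proof -
  have "(\<lambda>p. \<Sum>\<^sub>\<infinity>m\<in>{..fst p}. \<bar>c 0 (fst p - m)\<bar> * \<bar>c m (snd p)\<bar>) summable_on UNIV"
    using convolution_reindex(1)[OF convolution_triples_summable[OF assms]]
    by (intro summable_on_Sigma_banach) simp
  then have "(\<lambda>(h, n). \<bar>row_convolution c h n\<bar>) summable_on UNIV"
    by (rule norm_bound_summable(1)) (auto simp: row_convolution_def simp flip: abs_mult)
  then show ?thesis by (simp add: l1_matrix_def)
qed

lemma hamiltonian_coeff_eq_row_convolution:
  "hamiltonian_coeff c h k = row_convolution c h k + row_convolution c k h - c 0 h * c 0 k"
  by (simp add: hamiltonian_coeff_def row_convolution_def)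

lemma l1_matrix_hamiltonian_coeff:
  assumes "l1_matrix c"
  shows "l1_matrix (hamiltonian_coeff c)"
proof -
  have "(\<lambda>k. c 0 k) summable_on UNIV"
    using l1_matrix_row[OF assms, of 0] by (auto intro: abs_summable_summable)
  then show ?thesis
    unfolding hamiltonian_coeff_eq_row_convolution[abs_def]
    by (intro l1_matrix_diff l1_matrix_add l1_matrix_row_convolution l1_matrix_tensor
        l1_matrix_swap[OF l1_matrix_row_convolution] assms)
qed

definition pairing :: "(nat \<Rightarrow> nat \<Rightarrow> real) \<Rightarrow> (nat \<Rightarrow> 'v::real_inner) \<Rightarrow> (nat \<Rightarrow> 'v) \<Rightarrow> real" where
  "pairing c y w = (\<Sum>\<^sub>\<infinity>(h, k). c h k * (y h \<bullet> w k))"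

lemma pairing_term_bound:
  assumes "\<And>h. norm (y h) \<le> X" "\<And>h. norm (w h) \<le> Y"
  shows "\<bar>a * (y h \<bullet> w k)\<bar> \<le> X * Y * \<bar>a\<bar>"
proof -
  have "\<bar>y h \<bullet> w k\<bar> \<le> X * Y"
    using order.trans[OF norm_ge_zero assms(1)] assms
    by (intro order.trans[OF Cauchy_Schwarz_ineq2] mult_mono) auto
  then show ?thesis
    using mult_left_mono[of _ _ "\<bar>a\<bar>"] by (simp add: abs_mult mult.commute[of _ "\<bar>a\<bar>"])
qed

lemma pairing_summable:
  assumes c: "l1_matrix c" and y: "\<And>h. norm (y h) \<le> X" and w: "\<And>h. norm (w h) \<le> Y"
  shows "(\<lambda>(h, k). c h k * (y h \<bullet> w k)) summable_on UNIV"
    and "\<bar>pairing c y w\<bar> \<le> X * Y * (\<Sum>\<^sub>\<infinity>(h, k). \<bar>c h k\<bar>)"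
proof -
  have b: "norm (case p of (h, k) \<Rightarrow> c h k * (y h \<bullet> w k)) \<le> X * Y * (case p of (h, k) \<Rightarrow> \<bar>c h k\<bar>)" for p
    using pairing_term_bound[OF y w] by (auto split: prod.split)
  note s = summable_on_cmult_right[OF c[unfolded l1_matrix_def], of "X * Y"]
  show "(\<lambda>(h, k). c h k * (y h \<bullet> w k)) summable_on UNIV"
    by (rule norm_bound_summable(1)[OF s b])
  show "\<bar>pairing c y w\<bar> \<le> X * Y * (\<Sum>\<^sub>\<infinity>(h, k). \<bar>c h k\<bar>)"
    using norm_bound_summable(2)[OF s b]
    by (simp add: pairing_def infsum_cmult_right')
qed

lemma pairing_swap: "pairing c y w = pairing (\<lambda>h k. c k h) w y"
  unfolding pairing_def
  by (rule infsum_reindex_bij_witness[of UNIV prod.swap prod.swap UNIV]) (auto simp: inner_commute)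

lemma pairing_add:
  assumes "l1_matrix a" "l1_matrix b" and y: "\<And>h. norm (y h) \<le> X" "\<And>h. norm (w h) \<le> Y"
  shows "pairing (\<lambda>h k. a h k + b h k) y w = pairing a y w + pairing b y w"
  using infsum_add[OF pairing_summable(1)[OF assms(1) y] pairing_summable(1)[OF assms(2) y]]
  by (simp add: pairing_def case_prod_unfold algebra_simps)

lemma pairing_scale: "pairing (\<lambda>h k. s * a h k) y w = s * pairing a y w"
  by (simp add: pairing_def case_prod_unfold mult.assoc infsum_cmult_right')

lemma pairing_diff:
  assumes "l1_matrix a" "l1_matrix b" and y: "\<And>h. norm (y h) \<le> X" "\<And>h. norm (w h) \<le> Y"
  shows "pairing (\<lambda>h k. a h k - b h k) y w = pairing a y w - pairing b y w"
  using pairing_add[where y = y and w = w, OF assms(1) l1_matrix_scale[OF assms(2), of "-1"] y]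
    pairing_scale[of "-1" b y w] by simp

abbreviation row_sum :: "(nat \<Rightarrow> nat \<Rightarrow> real) \<Rightarrow> nat \<Rightarrow> (nat \<Rightarrow> 'v::real_normed_vector) \<Rightarrow> 'v" where
  "row_sum c m y \<equiv> (\<Sum>\<^sub>\<infinity>k. c m k *\<^sub>R y k)"

lemma row_sum_summable:
  fixes y :: "nat \<Rightarrow> 'v::{real_inner, banach}"
  assumes c: "l1_matrix c" and y: "\<And>h. norm (y h) \<le> X"
  shows "(\<lambda>k. c m k *\<^sub>R y k) summable_on UNIV"
proof (rule norm_bound_summable(1))
  show "(\<lambda>k. \<bar>c m k\<bar> * X) summable_on UNIV"
    by (rule summable_on_cmult_left[OF l1_matrix_row[OF c]])
qed (use y in \<open>auto intro: mult_left_mono\<close>)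

lemma row_sum_inner:
  fixes y w :: "nat \<Rightarrow> 'v::{real_inner, banach}"
  assumes c: "l1_matrix c" and y: "\<And>h. norm (y h) \<le> X" and w: "\<And>h. norm (w h) \<le> Y"
  shows "row_sum c m y \<bullet> row_sum c p w =
    (\<Sum>\<^sub>\<infinity>k. \<Sum>\<^sub>\<infinity>n. c m k * c p n * (y k \<bullet> w n))"
  unfolding inner_infsum_left[OF row_sum_summable[OF c y]]
  unfolding inner_infsum_right[OF row_sum_summable[OF c w]]
  by (simp add: mult_ac)

text \<open>
  Player \<open>m\<close> moves along the first row of the matrix, shifted by \<open>m\<close>, and this velocity is paired
  with row \<open>m\<close>.
\<close>

lemma transport_pairing:
  fixes y :: "nat \<Rightarrow> 'v::{real_inner, banach}"
  assumes c: "l1_matrix c" and y: "\<And>h. norm (y h) \<le> X"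
  defines "S \<equiv> \<lambda>m. row_sum c 0 (\<lambda>k. y (m + k)) \<bullet> row_sum c m y"
  shows "S summable_on UNIV" and "infsum S UNIV = pairing (row_convolution c) y y"
proof -
  define F where "F = (\<lambda>(m, k, n). c 0 k * c m n * (y (m + k) \<bullet> y n))"
  have F: "F summable_on UNIV"
  proof (rule norm_bound_summable(1))
    show "(\<lambda>p. X * X * (case p of (m, k, n) \<Rightarrow> \<bar>c 0 k\<bar> * \<bar>c m n\<bar>)) summable_on UNIV"
      by (rule summable_on_cmult_right[OF convolution_triples_summable[OF c]])
    show "norm (F p) \<le> X * X * (case p of (m, k, n) \<Rightarrow> \<bar>c 0 k\<bar> * \<bar>c m n\<bar>)" for p
      using pairing_term_bound[where y = y and w = y and a = "c 0 (fst (snd p)) * c (fst p) (snd (snd p))",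
          OF y y]
      by (simp add: F_def abs_mult case_prod_unfold)
  qed
  have S: "S m = (\<Sum>\<^sub>\<infinity>(k, n). F (m, k, n))" for m
  proof -
    have "(\<lambda>(k, n). F (m, k, n)) summable_on UNIV"
      using summable_on_SigmaD1[of "\<lambda>m p. F (m, p)" UNIV "\<lambda>_. UNIV" m] F by (simp add: case_prod_unfold)
    then have "(\<Sum>\<^sub>\<infinity>k. \<Sum>\<^sub>\<infinity>n. F (m, k, n)) = (\<Sum>\<^sub>\<infinity>(k, n). F (m, k, n))"
      using infsum_Sigma'_banach[of "\<lambda>k n. F (m, k, n)" UNIV "\<lambda>_. UNIV"] by simp
    moreover have "S m = (\<Sum>\<^sub>\<infinity>k. \<Sum>\<^sub>\<infinity>n. F (m, k, n))"
      unfolding S_def by (subst row_sum_inner[OF c y y]) (simp add: F_def)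
    ultimately show ?thesis by simp
  qed
  have S_fun: "S = (\<lambda>m. \<Sum>\<^sub>\<infinity>p. F (m, p))"
    by (rule ext) (simp add: S case_prod_unfold)
  have "(\<lambda>m. \<Sum>\<^sub>\<infinity>p. F (m, p)) summable_on UNIV"
    by (rule summable_on_Sigma_banach[where B = "\<lambda>_. UNIV"]) (use F in simp)
  then show "S summable_on UNIV"
    by (simp add: S_fun)
  have "infsum S UNIV = (\<Sum>\<^sub>\<infinity>m. \<Sum>\<^sub>\<infinity>p. F (m, p))"
    by (simp add: S_fun)
  also have "\<dots> = infsum F UNIV"
    using infsum_Sigma_banach[of F UNIV "\<lambda>_. UNIV"] F by simp
  also have "\<dots> = (\<Sum>\<^sub>\<infinity>p. \<Sum>m\<le>fst p. F (m, fst p - m, snd p))"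
    by (rule convolution_reindex(2)[OF F])
  also have "\<dots> = pairing (row_convolution c) y y"
    unfolding pairing_def row_convolution_def F_def
    by (intro infsum_cong) (auto simp: sum_distrib_right)
  finally show "infsum S UNIV = pairing (row_convolution c) y y" .
qed

text \<open>
  The sum over all players, player \<open>0\<close> included, is the convolution form. The own term of player
  \<open>0\<close> enters the equation with the factor one half only, so half of it is subtracted. Replacing
  the convolution matrix by its transpose does not change the form, which yields the symmetric
  expression.
\<close>

lemma hamiltonian_pairing:
  fixes y :: "nat \<Rightarrow> 'v::{real_inner, banach}"
  assumes c: "l1_matrix c" and y: "\<And>h. norm (y h) \<le> X"
  defines "S \<equiv> \<lambda>m. row_sum c 0 (\<lambda>k. y (m + k)) \<bullet> row_sum c m y"
  shows "1/2 * S 0 + infsum S {1..} = 1/2 * pairing (hamiltonian_coeff c) y y"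
proof -
  note S = transport_pairing[where y = y, OF c y, folded S_def]
  have "infsum S (insert 0 {1..}) = S 0 + infsum S {1..}"
    by (rule infsum_insert) (use summable_on_subset_banach[OF S(1)] in auto)
  moreover have "insert 0 {1..} = (UNIV :: nat set)" by auto
  ultimately have *: "infsum S {1..} = pairing (row_convolution c) y y - S 0"
    using S(2) by simp
  have c0: "(\<lambda>k. c 0 k) summable_on UNIV"
    using l1_matrix_row[OF c, of 0] by (auto intro: abs_summable_summable)
  note l1 = l1_matrix_row_convolution[OF c] l1_matrix_swap[OF l1_matrix_row_convolution[OF c]] l1_matrix_tensor[OF c0 c0]
  have "S 0 = pairing (\<lambda>h k. c 0 h * c 0 k) y y"
    unfolding S_def pairing_def
    using row_sum_inner[where y = y and w = y, OF c y y, of 0 0] infsum_Sigma'_banach[of "\<lambda>h k. c 0 h * c 0 k * (y h \<bullet> y k)" UNIV "\<lambda>_. UNIV"]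
      pairing_summable(1)[where y = y and w = y, OF l1(3) y y] by simp
  moreover have "pairing (hamiltonian_coeff c) y y = pairing (row_convolution c) y y
      + pairing (\<lambda>h k. row_convolution c k h) y y - pairing (\<lambda>h k. c 0 h * c 0 k) y y"
    unfolding hamiltonian_coeff_eq_row_convolution[abs_def]
    by (simp add: pairing_diff[where y = y and w = y, OF _ _ y y] pairing_add[where y = y and w = y, OF _ _ y y] l1 l1_matrix_add)
  ultimately show ?thesis
    using * pairing_swap[of "row_convolution c" y y] by simp
qed

section \<open>Quadratic value functions of a state\<close>

definition shifted :: "int \<Rightarrow> 'd::finite states \<Rightarrow> nat \<Rightarrow> real ^ 'd" where
  "shifted i x h = x (int h + i)"

definition quadratic_value ::
  "(nat \<Rightarrow> nat \<Rightarrow> real) \<Rightarrow> real \<Rightarrow> int \<Rightarrow> 'd::finite states \<Rightarrow> real" where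
  "quadratic_value c \<kappa> i x = 1/2 * pairing c (shifted i x) (shifted i x) + \<kappa>"

lemma norm_shifted: "norm (shifted i x h) \<le> norm x"
  unfolding shifted_def by (rule norm_bounded)

lemma shifted_linear:
  "shifted i (x + y) h = shifted i x h + shifted i y h"
  "shifted i (s *\<^sub>R x) h = s *\<^sub>R shifted i x h"
  by (simp_all add: shifted_def)

lemma bounded_bilinear_pairing:
  assumes c: "l1_matrix c"
  shows "bounded_bilinear (\<lambda>x y :: 'd::finite states. pairing c (shifted i x) (shifted i y))"
proof
  fix x x' y y' :: "'d states" and s :: real
  have sm: "(\<lambda>(h, k). c h k * (shifted i x h \<bullet> shifted i y k)) summable_on UNIV" for x y :: "'d states"
    by (rule pairing_summable(1)[OF c norm_shifted norm_shifted])
  show "pairing c (shifted i (x + x')) (shifted i y)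
      = pairing c (shifted i x) (shifted i y) + pairing c (shifted i x') (shifted i y)"
    using infsum_add[OF sm[of x y] sm[of x' y]]
    by (simp add: pairing_def shifted_linear inner_add_left distrib_left case_prod_unfold)
  show "pairing c (shifted i x) (shifted i (y + y'))
      = pairing c (shifted i x) (shifted i y) + pairing c (shifted i x) (shifted i y')"
    using infsum_add[OF sm[of x y] sm[of x y']]
    by (simp add: pairing_def shifted_linear inner_add_right distrib_left case_prod_unfold)
  show "pairing c (shifted i (s *\<^sub>R x)) (shifted i y) = s *\<^sub>R pairing c (shifted i x) (shifted i y)"
    "pairing c (shifted i x) (shifted i (s *\<^sub>R y)) = s *\<^sub>R pairing c (shifted i x) (shifted i y)"
    by (simp_all add: pairing_def shifted_linear mult.left_commute case_prod_unfold infsum_cmult_right')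
  show "\<exists>K. \<forall>x y :: 'd states. norm (pairing c (shifted i x) (shifted i y)) \<le> norm x * norm y * K"
  proof (intro exI allI)
    show "norm (pairing c (shifted i x) (shifted i y)) \<le> norm x * norm y * (\<Sum>\<^sub>\<infinity>(h, k). \<bar>c h k\<bar>)"
      for x y :: "'d states"
      unfolding real_norm_def by (rule pairing_summable(2)[OF c norm_shifted norm_shifted])
  qed
qed

text \<open>
  The gradient of a bounded symmetric quadratic form is a bounded linear function of the point, so
  the second derivative is constant.
\<close>

lemma C2_frechet_quadratic_form:
  fixes B :: "'a::real_normed_vector \<Rightarrow> 'a \<Rightarrow> real"
  assumes "bounded_bilinear B" and sym: "\<And>x y. B x y = B y x"
  shows "C2_frechet (\<lambda>x. 1/2 * B x x + \<kappa>)"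
proof -
  interpret bounded_bilinear B by fact
  obtain K where K: "\<And>x y. norm (B x y) \<le> norm x * norm y * K" and "K > 0"
    using pos_bounded by blast
  have ap: "blinfun_apply (Blinfun (B x)) = B x" for x
    by (rule bounded_linear_Blinfun_apply[OF bounded_linear_right])
  have L: "bounded_linear (\<lambda>x. Blinfun (B x))"
  proof (rule bounded_linear_intro)
    show "Blinfun (B (x + y)) = Blinfun (B x) + Blinfun (B y)" for x y
      by (rule blinfun_eqI) (simp add: ap plus_blinfun.rep_eq add_left)
    show "Blinfun (B (r *\<^sub>R x)) = r *\<^sub>R Blinfun (B x)" for r x
      by (rule blinfun_eqI) (simp add: ap scaleR_blinfun.rep_eq scaleR_left)
    show "norm (Blinfun (B x)) \<le> norm x * K" for x
      by (rule norm_blinfun_bound) (use K[of x] \<open>K > 0\<close> in \<open>auto simp: ap mult_ac\<close>)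
  qed
  show ?thesis
    unfolding C2_frechet_def
  proof (intro exI conjI allI)
    fix x
    have "((\<lambda>x. 1/2 * B x x + \<kappa>) has_derivative (\<lambda>h. 1/2 * (B x h + B h x) + 0)) (at x)"
      by (intro has_derivative_add has_derivative_mult_right has_derivative_const FDERIV has_derivative_ident)
    then show "((\<lambda>x. 1/2 * B x x + \<kappa>) has_derivative blinfun_apply (Blinfun (B x))) (at x)"
      by (simp add: ap sym[of _ x])
    show "((\<lambda>x. Blinfun (B x)) has_derivative blinfun_apply (Blinfun (\<lambda>x. Blinfun (B x)))) (at x)"
      using bounded_linear_imp_has_derivative[OF L] by (simp add: bounded_linear_Blinfun_apply[OF L])
    show "continuous_on UNIV (\<lambda>x::'a. Blinfun (\<lambda>x. Blinfun (B x)))"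
      by (rule continuous_on_const)
  qed
qed

lemma C2_frechet_quadratic_value:
  assumes "l1_matrix c" "\<And>h k. c h k = c k h"
  shows "C2_frechet (quadratic_value c \<kappa> i :: 'd::finite states \<Rightarrow> real)"
proof -
  have "pairing c (shifted i x) (shifted i y) = pairing c (shifted i y) (shifted i x)" for x y :: "'d states"
    using pairing_swap[of c "shifted i x" "shifted i y"] by (simp add: assms(2))
  then show ?thesis
    using C2_frechet_quadratic_form[OF bounded_bilinear_pairing[OF assms(1)]]
    unfolding quadratic_value_def[abs_def] by blast
qed

lemma shifted_bump:
  "shifted i (update_state 0 j w) k = (if int k + i = j then w else 0)"
  by (simp add: shifted_def)

lemma pairing_bump:
  fixes x :: "'d::finite states"
  assumes c: "l1_matrix c" and sym: "\<And>h k. c h k = c k h"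
  shows "pairing c (shifted i x) (shifted i (update_state 0 j w)) =
    (if i \<le> j then row_sum c (nat (j - i)) (shifted i x) \<bullet> w else 0)"
proof (cases "i \<le> j")
  case True
  let ?m = "nat (j - i)"
  have iff: "int k + i = j \<longleftrightarrow> k = ?m" for k using True by auto
  have "pairing c (shifted i x) (shifted i (update_state 0 j w)) =
      (\<Sum>\<^sub>\<infinity>(h, k)\<in>UNIV \<times> {?m}. c h k * (shifted i x h \<bullet> shifted i (update_state 0 j w) k))"
    unfolding pairing_def by (rule infsum_cong_neutral) (auto simp: shifted_bump iff split: if_splits)
  also have "\<dots> = (\<Sum>\<^sub>\<infinity>h. c ?m h * (shifted i x h \<bullet> w))"
    by (rule infsum_reindex_bij_witness[of _ "\<lambda>h. (h, ?m)" fst])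
      (auto simp: shifted_bump iff sym[of ?m])
  also have "\<dots> = row_sum c ?m (shifted i x) \<bullet> w"
    unfolding inner_infsum_left[OF row_sum_summable[where y = "shifted i x", OF c norm_shifted]]
    by simp
  finally show ?thesis using True by simp
next
  case False
  then have "pairing c (shifted i x) (shifted i (update_state 0 j w)) = 0"
    unfolding pairing_def by (intro infsum_0) (auto simp: shifted_bump)
  with False show ?thesis by simp
qed

lemma pairing_bump_bump:
  assumes c: "l1_matrix c" and sym: "\<And>h k. c h k = c k h"
  shows "pairing c (shifted i (update_state 0 j w)) (shifted i (update_state 0 j w)) =
    (if i \<le> j then c (nat (j - i)) (nat (j - i)) * (w \<bullet> w) else 0)"
proof (cases "i \<le> j")
  case True
  let ?m = "nat (j - i)"
  have iff: "int k + i = j \<longleftrightarrow> k = ?m" for k using True by auto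
  have "row_sum c ?m (shifted i (update_state 0 j w)) = (\<Sum>\<^sub>\<infinity>k\<in>{?m}. c ?m k *\<^sub>R w)"
    by (rule infsum_cong_neutral) (use True in \<open>auto simp: shifted_bump iff\<close>)
  then show ?thesis
    using True by (simp add: pairing_bump[OF c sym])
next
  case False
  then show ?thesis
    unfolding pairing_bump[OF c sym] by (simp only: False if_False)
qed

text \<open>
  In a single coordinate the value is a quadratic polynomial with scalar second derivative;
  gradient and Laplacian can be read off from this expansion.
\<close>

lemma quadratic_value_update:
  fixes x :: "'d::finite states"
  assumes c: "l1_matrix c" and sym: "\<And>h k. c h k = c k h"
  shows "quadratic_value c \<kappa> i (update_state x j y) = quadratic_value c \<kappa> i x
    + (if i \<le> j then row_sum c (nat (j - i)) (shifted i x) else 0) \<bullet> (y - x j)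
    + 1/2 * (if i \<le> j then c (nat (j - i)) (nat (j - i)) else 0) * ((y - x j) \<bullet> (y - x j))"
proof -
  let ?e = "update_state 0 j (y - x j)"
  interpret B: bounded_bilinear "\<lambda>x y :: 'd states. pairing c (shifted i x) (shifted i y)"
    by (rule bounded_bilinear_pairing[OF c])
  have e: "update_state x j y = x + ?e"
    by (rule bcontfun_eqI) simp
  have s: "pairing c (shifted i ?e) (shifted i x) = pairing c (shifted i x) (shifted i ?e)"
    using pairing_swap[of c "shifted i ?e" "shifted i x"] by (simp add: sym)
  show ?thesis
    unfolding quadratic_value_def e B.add_left B.add_right s pairing_bump_bump[OF c sym]
      pairing_bump[OF c sym, of i x]
    by (simp only: if_distribR if_distrib[of "\<lambda>v. v \<bullet> (y - x j)"] inner_zero_left split: if_split) simp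
qed

lemma gradient_eqI:
  assumes "GDERIV f y :> D"
  shows "gradient f y = D"
  unfolding gradient_def
proof (rule the_equality[where P = "\<lambda>D. GDERIV f y :> D", OF assms])
  fix D' assume "GDERIV f y :> D'"
  then have "(\<lambda>h. h \<bullet> D') = (\<lambda>h. h \<bullet> D)"
    using assms unfolding gderiv_def by (rule has_derivative_unique)
  then show "D' = D"
    by (metis vector_eq_ldot)
qed

lemma gradient_at_quadratic_value:
  fixes x :: "'d::finite states"
  assumes c: "l1_matrix c" and sym: "\<And>h k. c h k = c k h"
  shows "gradient_at j (quadratic_value c \<kappa> i) x =
    (if i \<le> j then row_sum c (nat (j - i)) (shifted i x) else 0)"
  unfolding gradient_at_def quadratic_value_update[OF c sym]
proof (rule gradient_eqI)
  let ?D = "if i \<le> j then row_sum c (nat (j - i)) (shifted i x) else 0"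
  let ?g = "if i \<le> j then c (nat (j - i)) (nat (j - i)) else 0"
  show "GDERIV (\<lambda>y. quadratic_value c \<kappa> i x + ?D \<bullet> (y - x j) + 1/2 * ?g * ((y - x j) \<bullet> (y - x j))) (x j) :> ?D"
    unfolding gderiv_def
    by (rule derivative_eq_intros refl)+ (simp add: inner_commute)
qed

lemma laplacian_at_quadratic_value:
  fixes x :: "'d::finite states"
  assumes c: "l1_matrix c" and sym: "\<And>h k. c h k = c k h"
  shows "laplacian_at j (quadratic_value c \<kappa> i) x =
    (if i \<le> j then real CARD('d) * c (nat (j - i)) (nat (j - i)) else 0)"
proof -
  define D where "D = (if i \<le> j then row_sum c (nat (j - i)) (shifted i x) else 0)"
  define \<mu> where "\<mu> = (if i \<le> j then c (nat (j - i)) (nat (j - i)) else 0)"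
  have "(deriv ^^ 2) (\<lambda>s. quadratic_value c \<kappa> i (update_state x j (x j + s *\<^sub>R b))) 0 = \<mu>"
    if b: "b \<in> Basis" for b :: "real ^ 'd"
  proof -
    have "deriv (\<lambda>s. quadratic_value c \<kappa> i x + s * (D \<bullet> b) + 1/2 * \<mu> * (s * s)) = (\<lambda>s. D \<bullet> b + \<mu> * s)"
      by (rule ext, rule DERIV_imp_deriv) (auto intro!: derivative_eq_intros)
    moreover have "deriv (\<lambda>s. D \<bullet> b + \<mu> * s) 0 = \<mu>"
      by (rule DERIV_imp_deriv) (auto intro!: derivative_eq_intros)
    moreover have "(\<lambda>s. quadratic_value c \<kappa> i (update_state x j (x j + s *\<^sub>R b)))
        = (\<lambda>s. quadratic_value c \<kappa> i x + s * (D \<bullet> b) + 1/2 * \<mu> * (s * s))"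
      using b by (simp add: quadratic_value_update[OF c sym] D_def \<mu>_def)
    ultimately show ?thesis
      by (simp add: numeral_2_eq_2)
  qed
  then show ?thesis
    by (simp add: laplacian_at_def laplacian_def \<mu>_def)
qed

lemma laplacian_series_quadratic_value:
  fixes x :: "'d::finite states"
  assumes c: "l1_matrix c" and sym: "\<And>h k. c h k = c k h"
  shows "(\<Sum>\<^sub>\<infinity>j. laplacian_at j (quadratic_value c \<kappa> i) x) = real CARD('d) * (\<Sum>\<^sub>\<infinity>h. c h h)"
proof -
  have "(\<Sum>\<^sub>\<infinity>j. laplacian_at j (quadratic_value c \<kappa> i) x) =
      (\<Sum>\<^sub>\<infinity>j\<in>{i..}. laplacian_at j (quadratic_value c \<kappa> i) x)"
    by (rule infsum_cong_neutral) (auto simp: laplacian_at_quadratic_value[OF c sym])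
  also have "\<dots> = (\<Sum>\<^sub>\<infinity>h. real CARD('d) * c h h)"
    by (rule infsum_reindex_bij_witness[of _ "\<lambda>h. i + int h" "\<lambda>j. nat (j - i)"])
      (auto simp: laplacian_at_quadratic_value[OF c sym])
  finally show ?thesis
    by (simp add: infsum_cmult_right')
qed

lemma drift_series_quadratic_value:
  fixes x :: "'d::finite states"
  assumes c: "l1_matrix c" and sym: "\<And>h k. c h k = c k h"
  shows "1/2 * (norm (gradient_at i (quadratic_value c \<kappa> i) x))\<^sup>2
      + (\<Sum>\<^sub>\<infinity>j\<in>- {i}. gradient_at j (quadratic_value c \<kappa> j) x \<bullet> gradient_at j (quadratic_value c \<kappa> i) x)
    = 1/2 * pairing (hamiltonian_coeff c) (shifted i x) (shifted i x)"
proof -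
  note grad = gradient_at_quadratic_value[OF c sym]
  let ?y = "shifted i x"
  \<comment> \<open>Player \<open>i + m\<close> contributes \<open>S m\<close>; players to the left of \<open>i\<close> do not act on the value of \<open>i\<close>.\<close>
  define S where "S m = row_sum c 0 (\<lambda>k. ?y (m + k)) \<bullet> row_sum c m ?y" for m
  have "(\<Sum>\<^sub>\<infinity>j\<in>- {i}. gradient_at j (quadratic_value c \<kappa> j) x \<bullet> gradient_at j (quadratic_value c \<kappa> i) x)
      = (\<Sum>\<^sub>\<infinity>j\<in>{i<..}. gradient_at j (quadratic_value c \<kappa> j) x \<bullet> gradient_at j (quadratic_value c \<kappa> i) x)"
    by (rule infsum_cong_neutral) (auto simp: grad)
  also have "\<dots> = infsum S {1..}"
  proof (rule infsum_reindex_bij_witness[of _ "\<lambda>m. i + int m" "\<lambda>j. nat (j - i)"])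
    fix j assume j: "j \<in> {i<..}"
    then have "shifted j x = (\<lambda>k. ?y (nat (j - i) + k))"
      by (auto simp: shifted_def fun_eq_iff algebra_simps)
    then show "S (nat (j - i)) =
        gradient_at j (quadratic_value c \<kappa> j) x \<bullet> gradient_at j (quadratic_value c \<kappa> i) x"
      using j by (simp add: grad S_def)
  qed auto
  finally have series: "(\<Sum>\<^sub>\<infinity>j\<in>- {i}. gradient_at j (quadratic_value c \<kappa> j) x \<bullet>
      gradient_at j (quadratic_value c \<kappa> i) x) = infsum S {1..}" .
  have "(norm (gradient_at i (quadratic_value c \<kappa> i) x))\<^sup>2 = S 0"
    by (simp add: grad S_def power2_norm_eq_inner)
  moreover have "1/2 * S 0 + infsum S {1..} = 1/2 * pairing (hamiltonian_coeff c) ?y ?y"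
    unfolding S_def[abs_def] by (rule hamiltonian_pairing[where y = ?y, OF c norm_shifted])
  ultimately show ?thesis
    by (simp only: series)
qed

section \<open>Riccati trajectories yield QSD solutions\<close>

text \<open>
  Weierstrass' test, for series without preferred order.
\<close>

lemma continuous_on_infsum:
  fixes a :: "'i \<Rightarrow> real \<Rightarrow> real"
  assumes "\<And>p. continuous_on S (a p)" and W: "W summable_on UNIV"
    and "\<And>p t. t \<in> S \<Longrightarrow> \<bar>a p t\<bar> \<le> W p"
  shows "continuous_on S (\<lambda>t. \<Sum>\<^sub>\<infinity>p. a p t)"
proof (rule uniform_limit_theorem)
  show "uniform_limit S (\<lambda>X t. \<Sum>p\<in>X. a p t) (\<lambda>t. \<Sum>\<^sub>\<infinity>p. a p t) (finite_subsets_at_top UNIV)"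
    using assms by (intro Weierstrass_m_test_general[OF _ W]) auto
  show "\<forall>\<^sub>F X in finite_subsets_at_top UNIV. continuous_on S (\<lambda>t. \<Sum>p\<in>X. a p t)"
    using assms(1) by (intro always_eventually allI continuous_on_sum)
qed simp

lemma infsum_prod_decode:
  fixes f :: "nat \<times> nat \<Rightarrow> real"
  assumes "f summable_on UNIV"
  shows "(\<lambda>n. f (prod_decode n)) sums infsum f UNIV"
proof -
  have "((\<lambda>n. f (prod_decode n)) has_sum infsum f UNIV) UNIV"
    using has_sum_infsum[OF assms] has_sum_reindex_bij_betw[OF bij_prod_decode, of f "infsum f UNIV"]
    by simp
  then show ?thesis by (rule has_sum_imp_sums)
qed

text \<open>
  Enumerating the index pairs reduces the claim to termwise differentiation of an ordinary series
  of functions.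
\<close>

lemma has_real_derivative_infsum:
  fixes a a' :: "nat \<times> nat \<Rightarrow> real \<Rightarrow> real"
  assumes S: "convex S" "t \<in> S"
    and der: "\<And>p t. t \<in> S \<Longrightarrow> (a p has_real_derivative a' p t) (at t within S)"
    and V: "V summable_on UNIV" and aV: "\<And>p t. t \<in> S \<Longrightarrow> \<bar>a p t\<bar> \<le> V p"
    and W: "W summable_on UNIV" and a'W: "\<And>p t. t \<in> S \<Longrightarrow> \<bar>a' p t\<bar> \<le> W p"
  shows "((\<lambda>t. \<Sum>\<^sub>\<infinity>p. a p t) has_real_derivative (\<Sum>\<^sub>\<infinity>p. a' p t)) (at t within S)"
proof -
  have a: "(\<lambda>p. a p t) summable_on UNIV" if "t \<in> S" for t
    by (rule norm_bound_summable(1)[OF V]) (use aV that in auto)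
  have a': "(\<lambda>p. a' p t) summable_on UNIV" if "t \<in> S" for t
    by (rule norm_bound_summable(1)[OF W]) (use a'W that in auto)
  have "uniform_limit S (\<lambda>n t. \<Sum>i<n. a' (prod_decode i) t) (\<lambda>t. \<Sum>i. a' (prod_decode i) t) sequentially"
    by (rule Weierstrass_m_test[OF _ sums_summable[OF infsum_prod_decode[OF W]]]) (use a'W in auto)
  then obtain s where s: "\<And>t. t \<in> S \<Longrightarrow> (\<lambda>n. a (prod_decode n) t) sums s t"
    "\<And>t. t \<in> S \<Longrightarrow> (s has_real_derivative (\<Sum>i. a' (prod_decode i) t)) (at t within S)"
    using has_field_derivative_series[where f = "\<lambda>n. a (prod_decode n)" and f' = "\<lambda>n. a' (prod_decode n)",
        OF S(1) der _ S(2) sums_summable[OF infsum_prod_decode[OF a[OF S(2)]]]] by blast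
  have "s t = (\<Sum>\<^sub>\<infinity>p. a p t)" if "t \<in> S" for t
    using sums_unique2[OF s(1)[OF that] infsum_prod_decode[OF a[OF that]]] .
  moreover have "(\<Sum>i. a' (prod_decode i) t) = (\<Sum>\<^sub>\<infinity>p. a' p t)"
    using infsum_prod_decode[OF a'[OF S(2)]] by (simp add: sums_iff)
  ultimately show ?thesis
    using has_field_derivative_transform_within[OF s(2)[OF S(2)] zero_less_one S(2)] by simp
qed

lemma l1_matrix_geometric:
  assumes "0 < r" "r < 1"
  shows "l1_matrix (\<lambda>h k. K * r ^ (h + k))"
proof -
  have "(\<lambda>n. r ^ n) summable_on UNIV"
    using assms by (intro summable_nonneg_imp_summable_on summable_geometric) auto
  then show ?thesis
    using l1_matrix_scale[OF l1_matrix_tensor[of "\<lambda>n. r ^ n" "\<lambda>n. r ^ n"], of K]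
    by (simp add: power_add)
qed

lemma summable_on_int_geometric:
  fixes i :: int and A r :: real
  assumes "0 < r" "r < 1"
  shows "(\<lambda>j. if i \<le> j then A * r ^ nat (j - i) else 0) summable_on S"
proof -
  have "(\<lambda>n. r ^ n) summable_on UNIV"
    using assms by (intro summable_nonneg_imp_summable_on summable_geometric) auto
  then have "(\<lambda>n. A * r ^ n) summable_on UNIV"
    by (rule summable_on_cmult_right)
  also have "(\<lambda>n. A * r ^ n) summable_on UNIV \<longleftrightarrow> (\<lambda>j. A * r ^ nat (j - i)) summable_on {i..}"
    by (rule summable_on_reindex_bij_witness[of _ "\<lambda>j. nat (j - i)" "\<lambda>n. i + int n"]) auto
  also have "\<dots> \<longleftrightarrow> (\<lambda>j. if i \<le> j then A * r ^ nat (j - i) else 0) summable_on UNIV"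
    by (rule summable_on_cong_neutral) auto
  finally show ?thesis
    by (rule summable_on_subset_banach) simp
qed

text \<open>
  A solution of the matrix Riccati equation in forward time whose entries decay geometrically,
  uniformly in time. The decay is stronger than mere summability: it provides the common majorants
  for the entries, for their time derivatives, and for the two series of the Nash system.
\<close>

locale riccati_trajectory =
  fixes F :: "nat \<Rightarrow> nat \<Rightarrow> real" and c :: "real \<Rightarrow> nat \<Rightarrow> nat \<Rightarrow> real" and T K r :: real
  assumes T: "T > 0" and r: "0 < r" "r < 1" and F: "l1_matrix F"
    and bound: "\<And>t h k. t \<in> {0..T} \<Longrightarrow> \<bar>c t h k\<bar> \<le> K * r ^ (h + k)"
    and sym: "\<And>t h k. c t h k = c t k h"
    and ode: "\<And>t h k. t \<in> {0..T} \<Longrightarrow>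
      ((\<lambda>t. c t h k) has_real_derivative hamiltonian_coeff (c t) h k - F h k) (at t within {0..T})"
begin

lemma K_nonneg: "K \<ge> 0"
  using bound[of 0 0 0] T by simp

lemma l1: "t \<in> {0..T} \<Longrightarrow> l1_matrix (c t)"
  using bound K_nonneg r by (intro l1_matrix_mono[OF l1_matrix_geometric[OF r, of K]]) auto

lemma continuous_coeff: "continuous_on {0..T} (\<lambda>t. c t h k)"
  by (rule DERIV_continuous_on[OF ode])

text \<open>
  A time-independent summable bound for the derivatives of the entries: the Hamiltonian
  coefficients are estimated with every entry replaced by its geometric bound.
\<close>

definition majorant :: "nat \<Rightarrow> nat \<Rightarrow> real" where
  "majorant h k = row_convolution (\<lambda>h k. K * r ^ (h + k)) h k
     + row_convolution (\<lambda>h k. K * r ^ (h + k)) k h + K * r ^ h * (K * r ^ k) + \<bar>F h k\<bar>"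

lemma l1_majorant: "l1_matrix majorant"
proof -
  have "(\<lambda>n. K * r ^ n) summable_on UNIV"
    using r by (intro summable_on_cmult_right summable_nonneg_imp_summable_on summable_geometric) auto
  moreover have "l1_matrix (\<lambda>h k. \<bar>F h k\<bar>)"
    using F by (simp add: l1_matrix_def)
  ultimately show ?thesis
    unfolding majorant_def[abs_def]
    by (intro l1_matrix_add l1_matrix_tensor l1_matrix_row_convolution
        l1_matrix_swap[OF l1_matrix_row_convolution] l1_matrix_geometric r)
qed

lemma derivative_bound:
  assumes t: "t \<in> {0..T}"
  shows "\<bar>hamiltonian_coeff (c t) h k - F h k\<bar> \<le> majorant h k"
proof -
  have conv: "\<bar>row_convolution (c t) h k\<bar> \<le> row_convolution (\<lambda>h k. K * r ^ (h + k)) h k" for h k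
    unfolding row_convolution_def
  proof (intro order.trans[OF sum_abs] sum_mono)
    fix m
    show "\<bar>c t 0 (h - m) * c t m k\<bar> \<le> K * r ^ (0 + (h - m)) * (K * r ^ (m + k))"
      unfolding abs_mult using K_nonneg r by (intro mult_mono bound[OF t]) auto
  qed
  have "\<bar>c t 0 h * c t 0 k\<bar> \<le> K * r ^ h * (K * r ^ k)"
    using bound[OF t, of 0 h] bound[OF t, of 0 k] K_nonneg r
    unfolding abs_mult by (intro mult_mono) auto
  with conv[of h k] conv[of k h] show ?thesis
    unfolding hamiltonian_coeff_eq_row_convolution majorant_def by linarith
qed

definition trace_at :: "real \<Rightarrow> real" where
  "trace_at t = (\<Sum>\<^sub>\<infinity>h. c t h h)"

lemma continuous_trace: "continuous_on {0..T} trace_at"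
  unfolding trace_at_def
proof (rule continuous_on_infsum[OF continuous_coeff])
  show "(\<lambda>h. K * r ^ h) summable_on UNIV"
    using r by (intro summable_on_cmult_right summable_nonneg_imp_summable_on summable_geometric) auto
  fix h t assume "t \<in> {0..T}"
  have "r ^ (h + h) \<le> r ^ h"
    using r by (intro power_decreasing) auto
  then have "K * r ^ (h + h) \<le> K * r ^ h"
    by (intro mult_left_mono K_nonneg)
  then show "\<bar>c t h h\<bar> \<le> K * r ^ h"
    using bound[OF \<open>t \<in> {0..T}\<close>, of h h] by linarith
qed

lemma continuous_hamiltonian:
  "continuous_on {0..T} (\<lambda>t. hamiltonian_coeff (c t) h k)"
  unfolding hamiltonian_coeff_def by (intro continuous_intros continuous_coeff)

lemma pairing_time_derivative:
  fixes y :: "nat \<Rightarrow> 'v::{real_inner, banach}"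
  assumes y: "\<And>h. norm (y h) \<le> X"
  shows "t \<in> {0..T} \<Longrightarrow> ((\<lambda>t. pairing (c t) y y) has_real_derivative
           pairing (hamiltonian_coeff (c t)) y y - pairing F y y) (at t within {0..T})"
    and "continuous_on {0..T} (\<lambda>t. pairing (hamiltonian_coeff (c t)) y y - pairing F y y)"
proof -
  define a where "a = (\<lambda>(h, k) t. c t h k * (y h \<bullet> y k))"
  define a' where "a' = (\<lambda>(h, k) t. (hamiltonian_coeff (c t) h k - F h k) * (y h \<bullet> y k))"
  have pa: "pairing (c t) y y = (\<Sum>\<^sub>\<infinity>p. a p t)" for t
    by (simp add: pairing_def a_def case_prod_unfold)
  have pa': "pairing (hamiltonian_coeff (c t)) y y - pairing F y y = (\<Sum>\<^sub>\<infinity>p. a' p t)"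
    if "t \<in> {0..T}" for t
    using pairing_diff[where y = y and w = y, OF l1_matrix_hamiltonian_coeff[OF l1[OF that]] F y y]
    by (simp add: pairing_def a'_def case_prod_unfold)
  have V: "(\<lambda>p. X * X * (case p of (h, k) \<Rightarrow> \<bar>K * r ^ (h + k)\<bar>)) summable_on UNIV"
    by (rule summable_on_cmult_right[OF l1_matrix_geometric[OF r, of K, unfolded l1_matrix_def]])
  have W: "(\<lambda>p. X * X * (case p of (h, k) \<Rightarrow> \<bar>majorant h k\<bar>)) summable_on UNIV"
    by (rule summable_on_cmult_right[OF l1_majorant[unfolded l1_matrix_def]])
  have aV: "\<bar>a p t\<bar> \<le> X * X * (case p of (h, k) \<Rightarrow> \<bar>K * r ^ (h + k)\<bar>)" if "t \<in> {0..T}" for p t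
  proof (cases p)
    case (Pair h k)
    have "X * X * \<bar>c t h k\<bar> \<le> X * X * \<bar>K * r ^ (h + k)\<bar>"
      using bound[OF that, of h k] by (intro mult_left_mono) auto
    then show ?thesis
      using pairing_term_bound[where y = y and w = y and a = "c t h k" and h = h and k = k, OF y y]
      by (simp add: Pair a_def)
  qed
  have a'W: "\<bar>a' p t\<bar> \<le> X * X * (case p of (h, k) \<Rightarrow> \<bar>majorant h k\<bar>)" if "t \<in> {0..T}" for p t
  proof (cases p)
    case (Pair h k)
    let ?a = "hamiltonian_coeff (c t) h k - F h k"
    have "X * X * \<bar>?a\<bar> \<le> X * X * \<bar>majorant h k\<bar>"
      using derivative_bound[OF that, of h k] by (intro mult_left_mono) auto
    then show ?thesis
      using pairing_term_bound[where y = y and w = y and a = ?a and h = h and k = k, OF y y]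
      by (simp add: Pair a'_def)
  qed
  have der: "(a p has_real_derivative a' p t) (at t within {0..T})" if "t \<in> {0..T}" for p t
    using ode[OF that, of "fst p" "snd p"] unfolding a_def a'_def case_prod_unfold
    by (intro DERIV_cmult_right) 
  have cont: "continuous_on {0..T} (a' p)" for p
    unfolding a'_def case_prod_unfold by (intro continuous_intros continuous_hamiltonian)
  show "((\<lambda>t. pairing (c t) y y) has_real_derivative
      pairing (hamiltonian_coeff (c t)) y y - pairing F y y) (at t within {0..T})" if t: "t \<in> {0..T}"
    unfolding pa pa'[OF t]
    by (rule has_real_derivative_infsum[OF _ t der V aV W a'W]) auto
  have "continuous_on {0..T} (\<lambda>t. \<Sum>\<^sub>\<infinity>p. a' p t)"
    by (rule continuous_on_infsum[OF cont W a'W])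
  then show "continuous_on {0..T} (\<lambda>t. pairing (hamiltonian_coeff (c t)) y y - pairing F y y)"
    by (rule continuous_on_eq) (simp add: pa')
qed

definition solution :: "int \<Rightarrow> real \<Rightarrow> 'd::finite states \<Rightarrow> real" where
  "solution i t = quadratic_value (c t) (real CARD('d) * integral {t..T} trace_at) i"

definition solution_rate :: "int \<Rightarrow> 'd::finite states \<Rightarrow> real \<Rightarrow> real" where
  "solution_rate i x t =
     1/2 * (pairing (hamiltonian_coeff (c t)) (shifted i x) (shifted i x)
       - pairing F (shifted i x) (shifted i x)) - real CARD('d) * trace_at t"

lemma solution_time_derivative:
  fixes x :: "'d::finite states"
  shows "t \<in> {0..T} \<Longrightarrow>
      ((\<lambda>t. solution i t x) has_real_derivative solution_rate i x t) (at t within {0..T})"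
    and "continuous_on {0..T} (solution_rate i x)"
proof -
  note p = pairing_time_derivative[where y = "shifted i x", OF norm_shifted]
  show "((\<lambda>t. solution i t x) has_real_derivative solution_rate i x t) (at t within {0..T})"
    if t: "t \<in> {0..T}"
  proof -
    have i: "((\<lambda>t. integral {t..T} trace_at) has_real_derivative - trace_at t) (at t within {0..T})"
      using integral_has_vector_derivative'[OF continuous_trace t]
      by (simp add: has_real_derivative_iff_has_vector_derivative)
    show ?thesis
      unfolding solution_def quadratic_value_def solution_rate_def
      by (rule derivative_eq_intros p(1)[OF t] i refl)+ simp
  qed
  show "continuous_on {0..T} (solution_rate i x)"
    unfolding solution_rate_def[abs_def]
    by (intro continuous_intros continuous_trace p(2))
qed

lemma row_sum_bound:
  assumes t: "t \<in> {0..T}" and y: "\<And>h. norm (y h :: 'v::{real_inner, banach}) \<le> X"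
  shows "norm (row_sum (c t) m y) \<le> K * X / (1 - r) * r ^ m"
proof -
  have g: "(\<lambda>n. r ^ n) summable_on UNIV"
    using r by (intro summable_nonneg_imp_summable_on summable_geometric) auto
  have "((\<lambda>n. r ^ n) has_sum 1 / (1 - r)) UNIV"
    using infsumI[OF has_sum_infsum[OF g]] has_sum_imp_sums[OF has_sum_infsum[OF g]] r
      has_sum_infsum[OF g] by (auto simp: sums_iff suminf_geometric)
  then have s: "((\<lambda>n. K * X * r ^ m * r ^ n) has_sum K * X * r ^ m * (1 / (1 - r))) UNIV"
    by (rule has_sum_cmult_right)
  have X: "X \<ge> 0" using order.trans[OF norm_ge_zero y] .
  have le: "norm (c t m n *\<^sub>R y n) \<le> K * X * r ^ m * r ^ n" for n
    using mult_mono[OF bound[OF t, of m n] y[of n]] K_nonneg r X by (simp add: power_add mult_ac)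
  have "norm (row_sum (c t) m y) \<le> (\<Sum>\<^sub>\<infinity>n. K * X * r ^ m * r ^ n)"
    by (rule norm_bound_summable(2)[OF has_sum_imp_summable[OF s] le])
  then show ?thesis
    unfolding infsumI[OF s] by (simp add: mult_ac)
qed

lemma solution_uniformly_summable:
  assumes "bounded B" "B \<subseteq> {0..T} \<times> UNIV"
  shows "uniformly_summable_on (\<lambda>j (t, x :: 'd::finite states). laplacian_at j (solution i t) x) UNIV B"
    and "uniformly_summable_on
      (\<lambda>j (t, x :: 'd::finite states). gradient_at j (solution j t) x \<bullet> gradient_at j (solution i t) x) (- {i}) B"
proof -
  obtain X where X: "\<And>p. p \<in> B \<Longrightarrow> norm p \<le> X"
    using assms(1) by (auto simp: bounded_iff)
  have tx: "t \<in> {0..T}" "norm x \<le> X" if "(t, x) \<in> B" for t and x :: "'d states"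
    using that assms(2) order.trans[OF norm_snd_le X[OF that]] by auto
  show "uniformly_summable_on (\<lambda>j (t, x :: 'd states). laplacian_at j (solution i t) x) UNIV B"
    unfolding uniformly_summable_on_def
  proof (rule Weierstrass_m_test_general[OF _ summable_on_int_geometric[OF r]])
    fix j :: int and p :: "real \<times> 'd states" assume "p \<in> B"
    then obtain t x where p: "p = (t, x)" "t \<in> {0..T}" using tx by (cases p) auto
    let ?m = "nat (j - i)"
    have "r ^ (?m + ?m) \<le> r ^ ?m"
      using r by (intro power_decreasing) auto
    then have "\<bar>c t ?m ?m\<bar> \<le> K * r ^ ?m"
      using bound[OF p(2), of ?m ?m] mult_left_mono[OF _ K_nonneg] by fastforce
    then show "norm (case p of (t, x) \<Rightarrow> laplacian_at j (solution i t) x) \<le>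
        (if i \<le> j then real CARD('d) * K * r ^ nat (j - i) else 0)"
      using p by (simp add: solution_def laplacian_at_quadratic_value[OF l1 sym] abs_mult mult_left_mono)
  qed
  show "uniformly_summable_on
      (\<lambda>j (t, x :: 'd states). gradient_at j (solution j t) x \<bullet> gradient_at j (solution i t) x) (- {i}) B"
    unfolding uniformly_summable_on_def
  proof (rule Weierstrass_m_test_general[OF _ summable_on_int_geometric[OF r]])
    fix j :: int and p :: "real \<times> 'd states" assume "p \<in> B"
    then obtain t x where p: "p = (t, x)" "t \<in> {0..T}" "norm x \<le> X" using tx by (cases p) auto
    let ?m = "nat (j - i)" and ?A = "K * X / (1 - r)"
    have y: "norm (shifted i x h) \<le> X" for i h
      using norm_shifted p(3) by (rule order.trans)
    have A: "?A \<ge> 0" using K_nonneg r order.trans[OF norm_ge_zero p(3)] by simp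
    have "\<bar>row_sum (c t) 0 (shifted j x) \<bullet> row_sum (c t) ?m (shifted i x)\<bar> \<le> ?A * r ^ 0 * (?A * r ^ ?m)"
      using A r by (intro order.trans[OF Cauchy_Schwarz_ineq2] mult_mono row_sum_bound[OF p(2)] y) auto
    then show "norm (case p of (t, x) \<Rightarrow> gradient_at j (solution j t) x \<bullet> gradient_at j (solution i t) x) \<le>
        (if i \<le> j then ?A * ?A * r ^ nat (j - i) else 0)"
      using p by (simp add: solution_def gradient_at_quadratic_value[OF l1 sym])
  qed
qed

text \<open>
  The Laplacian contributes \<open>d * tr c\<close>, and so does the time derivative of the integrated trace; the
  two cancel. What remains is the Riccati equation, read as an identity of quadratic forms.
\<close>

theorem QSD_solution_solution:
  "QSD_solution T (\<lambda>i x :: 'd::finite states. 1/2 * pairing F (shifted i x) (shifted i x))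
     (\<lambda>i x. 1/2 * pairing (c T) (shifted i x) (shifted i x)) solution"
  unfolding QSD_solution_def classical_solution_def
proof (intro conjI allI ballI impI)
  fix i :: int and x :: "'d states"
  show "continuous_on {0..T} (\<lambda>t. solution i t x)"
    by (rule DERIV_continuous_on[OF solution_time_derivative(1)])
  have d: "((\<lambda>t. solution i t x) has_real_derivative solution_rate i x t) (at t)"
    if "t \<in> {0<..<T}" for t
    using solution_time_derivative(1)[of t i x] at_within_Icc_at[of 0 t T] that by simp
  show "(\<lambda>t. solution i t x) C1_differentiable_on {0<..<T}"
    unfolding C1_differentiable_on_def
  proof (intro exI conjI ballI)
    show "((\<lambda>t. solution i t x) has_vector_derivative solution_rate i x t) (at t)"
      if "t \<in> {0<..<T}" for t
      using d[OF that] by (simp add: has_real_derivative_iff_has_vector_derivative)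
    show "continuous_on {0<..<T} (solution_rate i x)"
      by (rule continuous_on_subset[OF solution_time_derivative(2)]) auto
  qed
  show "C2_frechet (solution i t :: 'd states \<Rightarrow> real)" if "t \<in> {0..T}" for t
    unfolding solution_def by (rule C2_frechet_quadratic_value[OF l1[OF that] sym])
  show "- deriv (\<lambda>s. solution i s x) t - (\<Sum>\<^sub>\<infinity>j. laplacian_at j (solution i t) x)
      + 1/2 * (norm (gradient_at i (solution i t) x))\<^sup>2
      + (\<Sum>\<^sub>\<infinity>j\<in>- {i}. gradient_at j (solution j t) x \<bullet> gradient_at j (solution i t) x)
      = 1/2 * pairing F (shifted i x) (shifted i x)"
    if t: "t \<in> {0<..<T}" for t
  proof -
    have t': "t \<in> {0..T}" using t by simp
    note lc = l1[OF t'] sym[of t]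
    show ?thesis
      using DERIV_imp_deriv[OF d[OF t]] drift_series_quadratic_value[OF lc, of i _ x]
        laplacian_series_quadratic_value[OF lc, of _ i x]
      by (simp add: solution_def solution_rate_def trace_at_def algebra_simps)
  qed
  show "solution i T x = 1/2 * pairing (c T) (shifted i x) (shifted i x)"
    by (simp add: solution_def quadratic_value_def)
next
  fix i :: int and B :: "(real \<times> 'd states) set" assume "bounded B \<and> B \<subseteq> {0..T} \<times> UNIV"
  then show "uniformly_summable_on (\<lambda>j (t, x). laplacian_at j (solution i t) x) UNIV B"
    "uniformly_summable_on
      (\<lambda>j (t, x). gradient_at j (solution j t) x \<bullet> gradient_at j (solution i t) x) (- {i}) B"
    using solution_uniformly_summable by blast+
next
  have "trace_at absolutely_integrable_on {0..T}"
    by (rule absolutely_integrable_continuous_real[OF continuous_trace])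
  then show "QSD_form T (solution :: int \<Rightarrow> real \<Rightarrow> 'd states \<Rightarrow> real)"
    unfolding QSD_form_def
    using l1 by (intro exI[of _ c])
      (simp add: l1_matrix_def solution_def quadratic_value_def pairing_def shifted_def trace_at_def[abs_def])
qed

end

section \<open>QSD solutions come from Riccati trajectories\<close>

lemma l1_matrix_zero_extension: "l1_matrix (zero_extension l f)"
proof -
  obtain P where "\<And>h k. \<bar>zero_extension l f h k\<bar> \<le> P * (1/2) ^ (h + k)"
    using zero_extension_geometric_bound[of "1/2" l f] by auto
  then show ?thesis
    by (intro l1_matrix_mono[OF l1_matrix_geometric[of "1/2" P]]) (auto intro: order.trans[OF _ abs_ge_self])
qed

lemma quadratic_cost_eq_pairing:
  "quadratic_cost l f i x = 1/2 * pairing (zero_extension l f) (shifted i x) (shifted i x)"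
proof -
  have "pairing (zero_extension l f) (shifted i x) (shifted i x) =
      (\<Sum>\<^sub>\<infinity>(h, k)\<in>{..<l} \<times> {..<l}. f h k * (shifted i x h \<bullet> shifted i x k))"
    unfolding pairing_def by (rule infsum_cong_neutral) (auto simp: zero_extension_def split: if_splits)
  also have "\<dots> = (\<Sum>h<l. \<Sum>k<l. f h k * (x (int h + i) \<bullet> x (int k + i)))"
    by (simp add: shifted_def sum.cartesian_product)
  finally show ?thesis
    by (simp add: quadratic_cost_def)
qed

text \<open>
  The states involved have at most two nonzero coordinates, so that the infinite quadratic form
  reduces to a finite one.
\<close>

lemma pairing_polarisation:
  fixes b :: "real ^ 'd::finite"
  assumes M: "l1_matrix M" "\<And>h k. M h k = M k h" and b: "b \<bullet> b = 1"
  defines "Q \<equiv> \<lambda>x :: 'd states. pairing M (shifted 0 x) (shifted 0 x)"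
    and "E \<equiv> \<lambda>h. update_state 0 (int h) b"
  shows "M h k = (Q (E h + E k) - Q (E h) - Q (E k)) / 2"
proof -
  interpret B: bounded_bilinear "\<lambda>x y :: 'd states. pairing M (shifted 0 x) (shifted 0 y)"
    by (rule bounded_bilinear_pairing[OF M(1)])
  have "pairing M (shifted 0 (E h)) (shifted 0 (E k)) = M h k" for h k
  proof -
    have "row_sum M k (shifted 0 (E h)) = (\<Sum>\<^sub>\<infinity>m\<in>{h}. M k m *\<^sub>R b)"
      by (rule infsum_cong_neutral) (auto simp: E_def shifted_bump)
    then have "row_sum M k (shifted 0 (E h)) \<bullet> b = M h k"
      using b M(2) by simp
    then show ?thesis
      using pairing_bump[OF M, of 0 "E h" "int k" b] by (simp add: E_def)
  qed
  then show ?thesis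
    using M(2)[of h k] by (simp add: Q_def B.add_left B.add_right)
qed

lemma hamiltonian_coeff_symmetric:
  "hamiltonian_coeff c h k = hamiltonian_coeff c k h"
  by (simp add: hamiltonian_coeff_def)

text \<open>
  The Hamiltonian coefficient \<open>(h, k)\<close> depends on entries of smaller index sum and on the entry
  \<open>(h, k)\<close> itself. The latter occurs linearly, with factor \<open>2 * c 0 0\<close>, except for \<open>h = k = 0\<close>,
  where the coefficient is \<open>(c 0 0)\<^sup>2\<close>; writing the factor as \<open>a 0 0 + b 0 0\<close> covers both cases.
  On the edges \<open>h = 0\<close> and \<open>k = 0\<close> the entry appears at both ends of the longer convolution, which
  is why they are treated separately.
\<close>

lemma hamiltonian_coeff_triangular:
  assumes a: "\<And>h k. a h k = a k h" and b: "\<And>h k. b h k = b k h"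
    and eq: "\<And>h' k'. h' + k' < h + k \<Longrightarrow> a h' k' = b h' k'"
  shows "hamiltonian_coeff a h k - hamiltonian_coeff b h k = (a 0 0 + b 0 0) * (a h k - b h k)"
proof -
  have edge: "hamiltonian_coeff a 0 n - hamiltonian_coeff b 0 n = (a 0 0 + b 0 0) * (a 0 n - b 0 n)"
    if eq: "\<And>h' k'. h' + k' < n \<Longrightarrow> a h' k' = b h' k'" and n: "n > 0" for n
  proof -
    have H: "hamiltonian_coeff c 0 n = 2 * c 0 0 * c 0 n + (\<Sum>m\<in>{0<..<n}. c 0 (n - m) * c m 0)"
      if c: "\<And>h k. c h k = c k h" for c
      unfolding hamiltonian_coeff_def using n c[of n 0] by (simp add: sum_split_ends)
    have "(\<Sum>m\<in>{0<..<n}. a 0 (n - m) * a m 0) = (\<Sum>m\<in>{0<..<n}. b 0 (n - m) * b m 0)"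
      using eq by (intro sum.cong) auto
    then show ?thesis
      using eq[of 0 0] n unfolding H[OF a] H[OF b] by (simp add: algebra_simps)
  qed
  consider "h = 0" "k = 0" | "h = 0" "k > 0" | "h > 0" "k = 0" | "h > 0" "k > 0" by auto
  then show ?thesis
  proof cases
    case 1
    then show ?thesis by (simp add: hamiltonian_coeff_def algebra_simps)
  next
    case 2
    then show ?thesis using edge[of k] eq by simp
  next
    case 3
    then show ?thesis
      using edge[of h] eq a[of h 0] b[of h 0] by (simp add: hamiltonian_coeff_symmetric[of _ h 0])
  next
    case 4
    have H: "hamiltonian_coeff c h k = 2 * c 0 0 * c h k + (\<Sum>m<h. c 0 (h - m) * c m k)
        + (\<Sum>m<k. c 0 (k - m) * c m h) - c 0 h * c 0 k" if c: "\<And>h k. c h k = c k h" for c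
      unfolding hamiltonian_coeff_def using c[of k h] by (simp add: lessThan_Suc_atMost[symmetric])
    have "(\<Sum>m<h. a 0 (h - m) * a m k) = (\<Sum>m<h. b 0 (h - m) * b m k)"
      "(\<Sum>m<k. a 0 (k - m) * a m h) = (\<Sum>m<k. b 0 (k - m) * b m h)"
      using eq 4 by (auto intro!: sum.cong)
    moreover have "a 0 0 = b 0 0" "a 0 h = b 0 h" "a 0 k = b 0 k"
      using eq 4 by auto
    ultimately show ?thesis
      unfolding H[OF a] H[OF b] by (simp add: algebra_simps)
  qed
qed

text \<open>
  The difference of two solutions solves, entry after entry in the order of the index sum, a
  homogeneous linear equation with zero terminal value.
\<close>

lemma matrix_riccati_unique:
  fixes a b :: "real \<Rightarrow> nat \<Rightarrow> nat \<Rightarrow> real" and F :: "nat \<Rightarrow> nat \<Rightarrow> real"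
  assumes sym: "\<And>t h k. a t h k = a t k h" "\<And>t h k. b t h k = b t k h"
    and cont: "\<And>h k. continuous_on {0..T} (\<lambda>t. a t h k)" "\<And>h k. continuous_on {0..T} (\<lambda>t. b t h k)"
    and ode: "\<And>t h k. 0 < t \<Longrightarrow> t < T \<Longrightarrow>
        ((\<lambda>t. a t h k) has_real_derivative hamiltonian_coeff (a t) h k - F h k) (at t)"
      "\<And>t h k. 0 < t \<Longrightarrow> t < T \<Longrightarrow>
        ((\<lambda>t. b t h k) has_real_derivative hamiltonian_coeff (b t) h k - F h k) (at t)"
    and terminal: "\<And>h k. a T h k = b T h k" and t: "t \<in> {0..T}"
  shows "a t h k = b t h k"
  using t
proof (induction "h + k" arbitrary: h k t rule: less_induct)
  case less
  have "a t h k - b t h k = 0"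
  proof (rule linear_ode_zero[where x = "\<lambda>t. a t h k - b t h k" and k = "\<lambda>t. a t 0 0 + b t 0 0"
        and ?t0.0 = T and a = 0 and b = T])
    show "continuous_on {0..T} (\<lambda>t. a t 0 0 + b t 0 0)" "continuous_on {0..T} (\<lambda>t. a t h k - b t h k)"
      by (intro continuous_intros cont)+
    show "t \<in> {0..T}" "T \<in> {0..T}" "a T h k - b T h k = 0"
      using less.prems terminal by auto
    fix s assume s: "0 < s" "s < T"
    have "hamiltonian_coeff (a s) h k - hamiltonian_coeff (b s) h k
        = (a s 0 0 + b s 0 0) * (a s h k - b s h k)"
      using less.hyps s by (intro hamiltonian_coeff_triangular sym) auto
    then show "((\<lambda>t. a t h k - b t h k) has_real_derivative
        (a s 0 0 + b s 0 0) * (a s h k - b s h k)) (at s)"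
      using DERIV_diff[OF ode(1)[OF s, of h k] ode(2)[OF s, of h k]] by simp
  qed
  then show ?case by simp
qed

lemma pairing_symmetrise:
  fixes y :: "nat \<Rightarrow> 'v::{real_inner, banach}"
  assumes c: "l1_matrix c" and y: "\<And>h. norm (y h) \<le> X"
  shows "pairing (\<lambda>h k. 1/2 * (c h k + c k h)) y y = pairing c y y"
  unfolding pairing_scale
  using pairing_add[where y = y and w = y, OF c l1_matrix_swap[OF c] y y] pairing_swap[of c y y]
  by linarith

lemma QSD_form_symmetric_coefficients:
  fixes v :: "int \<Rightarrow> real \<Rightarrow> 'd::finite states \<Rightarrow> real"
  assumes "QSD_form T v"
  obtains e :: "real \<Rightarrow> nat \<Rightarrow> nat \<Rightarrow> real" where
    "\<And>t. t \<in> {0..T} \<Longrightarrow> l1_matrix (e t)" "\<And>t h k. e t h k = e t k h"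
    "\<And>i t. t \<in> {0..T} \<Longrightarrow>
      v i t = quadratic_value (e t) (real CARD('d) * integral {t..T} (\<lambda>s. \<Sum>\<^sub>\<infinity>h. e s h h)) i"
proof -
  obtain c where c: "\<And>t. t \<in> {0..T} \<Longrightarrow> l1_matrix (c t)"
    and v: "\<And>i t x. t \<in> {0..T} \<Longrightarrow> v i t x = 1/2 * pairing (c t) (shifted i x) (shifted i x)
      + real CARD('d) * integral {t..T} (\<lambda>s. \<Sum>\<^sub>\<infinity>h. c s h h)"
    using assms unfolding QSD_form_def pairing_def shifted_def l1_matrix_def by blast
  show ?thesis
  proof (rule that[of "\<lambda>t h k. 1/2 * (c t h k + c t k h)"])
    show "l1_matrix (\<lambda>h k. 1/2 * (c t h k + c t k h))" if "t \<in> {0..T}" for t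
      by (rule l1_matrix_scale[OF l1_matrix_add[OF c[OF that] l1_matrix_swap[OF c[OF that]]]])
    show "v i t = quadratic_value (\<lambda>h k. 1/2 * (c t h k + c t k h))
        (real CARD('d) * integral {t..T} (\<lambda>s. \<Sum>\<^sub>\<infinity>h. 1/2 * (c s h h + c s h h))) i"
      if t: "t \<in> {0..T}" for i t
    proof (rule ext)
      fix x :: "'d states"
      have half: "1/2 * (c s h h + c s h h) = c s h h" for s h by simp
      show "v i t x = quadratic_value (\<lambda>h k. 1/2 * (c t h k + c t k h))
          (real CARD('d) * integral {t..T} (\<lambda>s. \<Sum>\<^sub>\<infinity>h. 1/2 * (c s h h + c s h h))) i x"
        unfolding half quadratic_value_def pairing_symmetrise[where y = "shifted i x", OF c[OF t] norm_shifted]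
        by (rule v[OF t])
    qed
  qed simp
qed

text \<open>
  The definition of a QSD solution demands no regularity in time of the single coefficients, but
  the regularity of the values carries over to them. Evaluating at the state \<open>0\<close> isolates the trace
  term, and subtracting this value leaves the quadratic form alone. Polarisation then expresses
  each coefficient through finitely many values, and the Nash system becomes the Riccati equation
  for the coefficients.
\<close>

lemma QSD_solution_coefficients:
  fixes v :: "int \<Rightarrow> real \<Rightarrow> 'd::finite states \<Rightarrow> real"
  assumes T: "T > 0" and F: "l1_matrix F" "\<And>h k. F h k = F k h" and G: "l1_matrix G" "\<And>h k. G h k = G k h"
    and v: "QSD_solution T (\<lambda>i x. 1/2 * pairing F (shifted i x) (shifted i x))
      (\<lambda>i x. 1/2 * pairing G (shifted i x) (shifted i x)) v"
  obtains e :: "real \<Rightarrow> nat \<Rightarrow> nat \<Rightarrow> real" where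
    "\<And>t h k. e t h k = e t k h" "\<And>h k. continuous_on {0..T} (\<lambda>t. e t h k)"
    "\<And>t h k. 0 < t \<Longrightarrow> t < T \<Longrightarrow>
      ((\<lambda>t. e t h k) has_real_derivative hamiltonian_coeff (e t) h k - F h k) (at t)"
    "\<And>h k. e T h k = G h k"
    "\<And>i t. t \<in> {0..T} \<Longrightarrow>
      v i t = quadratic_value (e t) (real CARD('d) * integral {t..T} (\<lambda>s. \<Sum>\<^sub>\<infinity>h. e s h h)) i"
proof -
  have form: "QSD_form T v"
    using v by (simp add: QSD_solution_def)
  obtain e where l1: "\<And>t. t \<in> {0..T} \<Longrightarrow> l1_matrix (e t)" and sym: "\<And>t h k. e t h k = e t k h"
    and ve: "\<And>i t. t \<in> {0..T} \<Longrightarrow>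
      v i t = quadratic_value (e t) (real CARD('d) * integral {t..T} (\<lambda>s. \<Sum>\<^sub>\<infinity>h. e s h h)) i"
    by (rule QSD_form_symmetric_coefficients[OF form]) (rule that; assumption)
  have cs: "classical_solution T (\<lambda>i x. 1/2 * pairing F (shifted i x) (shifted i x))
      (\<lambda>i x. 1/2 * pairing G (shifted i x) (shifted i x)) v"
    using v by (simp add: QSD_solution_def)
  have v_cont: "continuous_on {0..T} (\<lambda>t. v i t x)"
    and v_C1: "(\<lambda>t. v i t x) C1_differentiable_on {0<..<T}"
    and v_T: "v i T x = 1/2 * pairing G (shifted i x) (shifted i x)" for i x
    using cs unfolding classical_solution_def by blast+
  have pde: "- deriv (\<lambda>s. v i s x) t - (\<Sum>\<^sub>\<infinity>j. laplacian_at j (v i t) x)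
       + 1/2 * (norm (gradient_at i (v i t) x))\<^sup>2
       + (\<Sum>\<^sub>\<infinity>j\<in>- {i}. gradient_at j (v j t) x \<bullet> gradient_at j (v i t) x)
       = 1/2 * pairing F (shifted i x) (shifted i x)" if "t \<in> {0<..<T}" for t i x
    using cs that unfolding classical_solution_def by blast
  have v_deriv: "((\<lambda>s. v i s x) has_real_derivative
      1/2 * pairing (hamiltonian_coeff (e t)) (shifted i x) (shifted i x)
      - 1/2 * pairing F (shifted i x) (shifted i x) - real CARD('d) * (\<Sum>\<^sub>\<infinity>h. e t h h)) (at t)"
    if t: "t \<in> {0<..<T}" for t i x
  proof -
    have t': "t \<in> {0..T}" using t by simp
    let ?\<kappa> = "real CARD('d) * integral {t..T} (\<lambda>s. \<Sum>\<^sub>\<infinity>h. e s h h)"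
    have "(\<lambda>s. v i s x) differentiable at t"
      using v_C1 t by (auto simp: C1_differentiable_on_eq)
    then have "((\<lambda>s. v i s x) has_real_derivative deriv (\<lambda>s. v i s x) t) (at t)"
      using DERIV_deriv_iff_real_differentiable by blast
    moreover have "deriv (\<lambda>s. v i s x) t =
        1/2 * pairing (hamiltonian_coeff (e t)) (shifted i x) (shifted i x)
        - 1/2 * pairing F (shifted i x) (shifted i x) - real CARD('d) * (\<Sum>\<^sub>\<infinity>h. e t h h)"
      using pde[OF t, of i x] drift_series_quadratic_value[OF l1[OF t'] sym, of i ?\<kappa> x]
        laplacian_series_quadratic_value[OF l1[OF t'] sym, of ?\<kappa> i x]
      unfolding ve[OF t'] by linarith
    ultimately show ?thesis by simp
  qed
  define Q where "Q M x = pairing M (shifted 0 x) (shifted 0 x)" for M and x :: "'d states"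
  have Q0: "Q M 0 = 0" for M
    by (simp add: Q_def pairing_def shifted_def case_prod_unfold)
  have Q: "Q (e t) x = 2 * (v 0 t x - v 0 t 0)" if "t \<in> {0..T}" for t x
    using Q0[of "e t"] by (simp add: ve[OF that] quadratic_value_def Q_def)
  have Q_cont: "continuous_on {0..T} (\<lambda>t. Q (e t) x)" for x
    by (rule continuous_on_eq[where f = "\<lambda>t. 2 * (v 0 t x - v 0 t 0)"])
      (auto intro!: continuous_intros v_cont simp: Q)
  have Q_deriv: "((\<lambda>t. Q (e t) x) has_real_derivative Q (hamiltonian_coeff (e t)) x - Q F x) (at t)"
    if t: "0 < t" "t < T" for t x
  proof (rule has_field_derivative_transform_within_open[where S = "{0<..<T}" and f = "\<lambda>t. 2 * (v 0 t x - v 0 t 0)"])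
    have "((\<lambda>t. 2 * (v 0 t x - v 0 t 0)) has_real_derivative
        2 * ((1/2 * Q (hamiltonian_coeff (e t)) x - 1/2 * Q F x - real CARD('d) * (\<Sum>\<^sub>\<infinity>h. e t h h))
          - (1/2 * Q (hamiltonian_coeff (e t)) 0 - 1/2 * Q F 0 - real CARD('d) * (\<Sum>\<^sub>\<infinity>h. e t h h)))) (at t)"
      unfolding Q_def using t by (intro DERIV_cmult DERIV_diff v_deriv) auto
    then show "((\<lambda>t. 2 * (v 0 t x - v 0 t 0)) has_real_derivative
        Q (hamiltonian_coeff (e t)) x - Q F x) (at t)"
      by (simp add: Q0)
  qed (use t in \<open>auto simp: Q\<close>)
  obtain b :: "real ^ 'd" where "b \<in> Basis" using nonempty_Basis by blast
  then have b: "b \<bullet> b = 1" by simp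
  define E :: "nat \<Rightarrow> 'd states" where "E h = update_state 0 (int h) b" for h
  have coeff: "M h k = (Q M (E h + E k) - Q M (E h) - Q M (E k)) / 2"
    if "l1_matrix M" "\<And>h k. M h k = M k h" for M h k
    using pairing_polarisation[OF that b] by (simp add: Q_def E_def)
  show ?thesis
  proof (rule that[OF sym _ _ _ ve])
    fix h k
    show "continuous_on {0..T} (\<lambda>t. e t h k)"
      by (rule continuous_on_eq[where f = "\<lambda>t. (Q (e t) (E h + E k) - Q (e t) (E h) - Q (e t) (E k)) / 2"])
        (auto intro!: continuous_intros Q_cont simp: coeff[OF l1 sym, of _ h k])
    show "e T h k = G h k"
    proof -
      have "Q (e T) x = Q G x" for x
        using Q[of T x] T v_T[of 0 x] v_T[of 0 0] Q0[of G] by (simp add: Q_def)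
      then show ?thesis
        using coeff[OF l1 sym, of T h k] coeff[OF G, of h k] T by simp
    qed
    fix t assume t: "0 < t" "t < T"
    then have t': "t \<in> {0..T}" by simp
    show "((\<lambda>t. e t h k) has_real_derivative hamiltonian_coeff (e t) h k - F h k) (at t)"
    proof (rule has_field_derivative_transform_within_open
        [where S = "{0<..<T}" and f = "\<lambda>t. (Q (e t) (E h + E k) - Q (e t) (E h) - Q (e t) (E k)) / 2"])
      have "((\<lambda>t. (Q (e t) (E h + E k) - Q (e t) (E h) - Q (e t) (E k)) / 2) has_real_derivative
          ((Q (hamiltonian_coeff (e t)) (E h + E k) - Q F (E h + E k))
            - (Q (hamiltonian_coeff (e t)) (E h) - Q F (E h))
            - (Q (hamiltonian_coeff (e t)) (E k) - Q F (E k))) / 2) (at t)"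
        by (intro DERIV_cdivide DERIV_diff Q_deriv t)
      also have "((Q (hamiltonian_coeff (e t)) (E h + E k) - Q F (E h + E k))
            - (Q (hamiltonian_coeff (e t)) (E h) - Q F (E h))
            - (Q (hamiltonian_coeff (e t)) (E k) - Q F (E k))) / 2 = hamiltonian_coeff (e t) h k - F h k"
        using coeff[OF l1_matrix_hamiltonian_coeff[OF l1[OF t']] hamiltonian_coeff_symmetric, of h k]
          coeff[OF F, of h k] by (simp add: field_simps)
      finally show "((\<lambda>t. (Q (e t) (E h + E k) - Q (e t) (E h) - Q (e t) (E k)) / 2) has_real_derivative
          hamiltonian_coeff (e t) h k - F h k) (at t)" .
    qed (use t in \<open>auto simp: coeff[OF l1 sym, of _ h k]\<close>)
  qed
qed

section \<open>Existence and uniqueness\<close>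

theorem theorem2p22:
  fixes l :: nat and \<rho> T :: real and f g :: "nat \<Rightarrow> nat \<Rightarrow> real" and I :: "real set"
  assumes "\<rho> > 1"
    and "symmetric_upto l f" and "symmetric_upto l g"
    and "is_interval I" and "T > 0" and "{0..T} \<subseteq> I"
    and "strongly_gathering l \<rho> f"
    and "compatible l \<rho> f I g"
  shows "\<exists>u :: int \<Rightarrow> real \<Rightarrow> 'd::finite states \<Rightarrow> real.
           QSD_solution T (quadratic_cost l f) (quadratic_cost l g) u \<and>
           (\<forall>v. QSD_solution T (quadratic_cost l f) (quadratic_cost l g) v \<longrightarrow>
                (\<forall>i. \<forall>t\<in>{0..T}. \<forall>x. v i t x = u i t x))"
proof -
  let ?F = "zero_extension l f" and ?G = "zero_extension l g"
  note T = \<open>T > 0\<close>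
  obtain \<gamma> K r where r: "0 < r" "r < 1"
    and bound: "\<And>h k t. t \<in> {0..T} \<Longrightarrow> \<bar>\<gamma> h k t\<bar> \<le> K * r ^ (h + k)"
    and \<gamma>_sym: "\<And>h k t. \<gamma> h k t = \<gamma> k h t" and initial: "\<And>h k. \<gamma> h k 0 = ?G h k"
    and \<gamma>_ode: "\<And>h k t. t \<in> {0..T} \<Longrightarrow>
      (\<gamma> h k has_real_derivative ?F h k - hamiltonian_coeff (\<lambda>h k. \<gamma> h k t) h k) (at t within {0..T})"
    by (rule matrix_riccati_flow[OF assms(1-3,5-8)]) (rule that; assumption)
  \<comment> \<open>Back from the time to maturity to the time of the game.\<close>
  define c where "c t h k = \<gamma> h k (T - t)" for t h k
  have c_sym: "c t h k = c t k h" for t h k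
    by (simp add: c_def \<gamma>_sym[of h])
  have c_ode: "((\<lambda>t. c t h k) has_real_derivative hamiltonian_coeff (c t) h k - ?F h k) (at t within {0..T})"
    if t: "t \<in> {0..T}" for t h k
  proof -
    have img: "(\<lambda>t. T - t) ` {0..T} = {0..T}"
      by (auto simp: image_iff intro: bexI[of _ "T - _"])
    have "((\<gamma> h k \<circ> (\<lambda>t. T - t)) has_real_derivative
        (?F h k - hamiltonian_coeff (\<lambda>h k. \<gamma> h k (T - t)) h k) * (0 - 1)) (at t within {0..T})"
      by (rule DERIV_image_chain)
        (use \<gamma>_ode[of "T - t" h k] t in \<open>auto simp: img intro!: derivative_eq_intros\<close>)
    then show ?thesis
      by (simp add: c_def[abs_def] o_def)
  qed
  interpret riccati_trajectory ?F c T K r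
  proof
    show "\<bar>c t h k\<bar> \<le> K * r ^ (h + k)" if "t \<in> {0..T}" for t h k
      using that by (simp add: c_def bound)
  qed (use T r l1_matrix_zero_extension c_sym c_ode in auto)
  have costs: "quadratic_cost l f = (\<lambda>i x :: 'd states. 1/2 * pairing ?F (shifted i x) (shifted i x))"
    "quadratic_cost l g = (\<lambda>i x :: 'd states. 1/2 * pairing ?G (shifted i x) (shifted i x))"
    by (simp_all add: fun_eq_iff quadratic_cost_eq_pairing)
  have cT: "c T = ?G"
    by (simp add: c_def fun_eq_iff initial)
  show ?thesis
  proof (intro exI conjI allI impI ballI)
    show "QSD_solution T (quadratic_cost l f) (quadratic_cost l g) (solution :: int \<Rightarrow> real \<Rightarrow> 'd states \<Rightarrow> real)"
      using QSD_solution_solution unfolding costs cT .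
  next
    fix v :: "int \<Rightarrow> real \<Rightarrow> 'd states \<Rightarrow> real" and i t x
    assume v: "QSD_solution T (quadratic_cost l f) (quadratic_cost l g) v" and t: "t \<in> {0..T}"
    obtain e where e_sym: "\<And>t h k. e t h k = e t k h"
      and e_cont: "\<And>h k. continuous_on {0..T} (\<lambda>t. e t h k)"
      and e_ode: "\<And>t h k. 0 < t \<Longrightarrow> t < T \<Longrightarrow>
        ((\<lambda>t. e t h k) has_real_derivative hamiltonian_coeff (e t) h k - ?F h k) (at t)"
      and e_T: "\<And>h k. e T h k = ?G h k"
      and e: "\<And>i t. t \<in> {0..T} \<Longrightarrow>
        v i t = quadratic_value (e t) (real CARD('d) * integral {t..T} (\<lambda>s. \<Sum>\<^sub>\<infinity>h. e s h h)) i"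
      by (rule QSD_solution_coefficients[OF T l1_matrix_zero_extension zero_extension_symmetric[OF assms(2)]
            l1_matrix_zero_extension zero_extension_symmetric[OF assms(3)] v[unfolded costs]])
        (rule that; assumption)
    have c_ode_interior: "((\<lambda>t. c t h k) has_real_derivative hamiltonian_coeff (c s) h k - ?F h k) (at s)"
      if "0 < s" "s < T" for s h k
      using c_ode[of s h k] at_within_Icc_at[OF that] that by simp
    have "e s h k = c s h k" if "s \<in> {0..T}" for s h k
      by (rule matrix_riccati_unique[where a = e and b = c and F = ?F and T = T,
            OF e_sym c_sym e_cont continuous_coeff e_ode c_ode_interior _ that])
        (simp_all add: e_T cT)
    then have "e s = c s" if "s \<in> {0..T}" for s
      using that by (simp add: fun_eq_iff)
    moreover from this have "integral {t..T} (\<lambda>s. \<Sum>\<^sub>\<infinity>h. e s h h) = integral {t..T} trace_at"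
      using t by (intro integral_cong) (simp add: trace_at_def)
    ultimately show "v i t x = solution i t x"
      using t by (simp add: e solution_def)
  qed
qed

end
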